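(* Consider the online protocol and the OMMA algorithm described in the context, in either the multi-class setting (put $a=1$, $b=1$) or the multi-label setting (put $a=m$, $b=\sqrt2$), with known horizon $n\ge1$. Let $\psi$ be a concave, closed (not necessarily smooth) utility on $\mathcal{C}$. (i) Let $\{\psi_\gamma:\gamma>0\}$ be a $\gamma$-smoothing of $\psi$ with parameters $(\alpha,\beta)$, $\alpha,\beta>0$, and let $L_\gamma$ be a Lipschitz constant of $\psi_\gamma$ on $\mathcal{C}$. If OMMA is run with $\psi$ replaced by $\psi_\gamma$, where $\gamma=\sqrt{\frac{a\beta(1+\ln n)}{\alpha n}}$, then its regret with respect to the original utility $\psi$ satisfies $$R_n\le2\sqrt{\frac{a\alpha\beta(1+\ln n)}{n}}+\frac{2bL_\gamma}{n}\sum_{t=1}^n\mathbb{E}\big[\|\eta(x_t)-\widehat\eta_t(x_t)\|\big].$$ (ii) If moreover $\psi$ is $L$-Lipschitz on $\mathcal{C}$ with $L>0$, and OMMA is run with $\psi$ replaced by $$\psi_\gamma(C)=\max_{C'\in\mathcal{C}}\Big\{\psi(C')-\frac1{2\gamma}\|C-C'\|^2\Big\},\qquad \gamma=\sqrt{\frac{2a(1+\ln n)}{L^2n}},$$ then $$R_n\le L\sqrt{\frac{2a(1+\ln n)}{n}}+\frac{2bL}{n}\sum_{t=1}^n\mathbb{E}\big[\|\eta(x_t)-\widehat\eta_t(x_t)\|\big].$$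
   Context: Data. $(x,y)\sim\mathbb{P}$ with $x\in\mathcal{X}$ and label vector $y\in\mathcal{Y}\subseteq\{0,1\}^m$; $\eta(x)=\mathbb{E}[y\mid x]\in[0,1]^m$. Multi-class setting: $\mathcal{Y}$ is the set of one-hot vectors, and the set of allowed predictions $\widehat{\mathcal{Y}}$ is also the set of one-hot vectors. Multi-label setting: $\mathcal{Y}=\{0,1\}^m$ and $\widehat{\mathcal{Y}}\subseteq\{0,1\}^m$ is a nonempty set of allowed predictions (e.g. all of $\{0,1\}^m$, or all vectors with exactly $k$ ones). Confusion matrices. For a single pair $(y,\widehat y)$: multi-class, $C(y,\widehat y)\in\mathbb{R}^{m\times m}$ with $C_{j\ell}=y_j\widehat y_\ell$; multi-label, $C(y,\widehat y)\in\mathbb{R}^{m\times2\times2}$ with $C_{juv}=\mathbf 1\{y_j=u\}\mathbf 1\{\widehat y_j=v\}$, $u,v\in\{0,1\}$. For sequences: $C(y^n,\widehat y^n)=\frac1n\sum_{t=1}^nC(y_t,\widehat y_t)$. Expectations of $C(y,\widehat y)$ over $y$ with $\widehat y$ fixed depend only on the marginals $\mathbb{E}[y]$; $\mathbb{E}_{y\sim q}[C(y,\widehat y)]$ denotes this expectation when $\mathbb{E}[y]=q$. $\mathcal{C}$ is the convex hull of $\{C(y,\widehat y):y\in\mathcal{Y},\widehat y\in\widehat{\mathcal{Y}}\}$. $\cdot$ is the entrywise dot product and $\|\cdot\|$ the entrywise (Euclidean) $L_2$-norm. Smoothing. A collection of concave functions $\{\psi_\gamma:\gamma>0\}$ is a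 $\gamma$-smoothing of a concave closed $\psi$ with parameters $(\alpha,\beta)$ if for every $\gamma>0$: $0\le\psi(C)-\psi_\gamma(C)\le\alpha\gamma$ for all $C\in\mathcal{C}$, and $\psi_\gamma$ is differentiable (on a neighbourhood of $\mathcal{C}$) and $\frac\beta\gamma$-smooth, i.e. $\|\nabla\psi_\gamma(C_1)-\nabla\psi_\gamma(C_2)\|\le\frac\beta\gamma\|C_1-C_2\|$ for $C_1,C_2\in\mathcal{C}$. Online protocol. $(x_1,y_1),\dots,(x_n,y_n)$ are i.i.d. from $\mathbb{P}$. At trial $t$ the algorithm observes $x_t$, receives an estimate $\widehat\eta_t(x_t)$ of $\eta(x_t)$ (a probability vector in the multi-class setting, an element of $[0,1]^m$ in the multi-label setting), where $\widehat\eta_t$ may depend only on $x_t,(x_1,y_1),\dots,(x_{t-1},y_{t-1})$, predicts $\widehat y_t\in\widehat{\mathcal{Y}}$, and then observes $y_t$. OMMA run with a differentiable utility $\phi$. Start from an arbitrary $C_0\in\mathcal{C}$. At trial $t$, predict $\widehat y_t\in\arg\max_{\widehat y\in\widehat{\mathcal{Y}}}\nabla\phi(C_{t-1})\cdot\mathbb{E}_{y_t\sim\widehat\eta_t(x_t)}[C(y_t,\widehat y)]$, and after observing $y_t$ set $C_t=\frac{t-1}{t}C_{t-1}+\frac1tC(y_t,\widehat y_t)$. Regret. Let $h^\star$ be a maximizer, over measurable classifiers $h:\mathcal{X}\to\widehat{\mathcal{Y}}$, of $\mathbb{E}[\psi(C(y^n,h(x^n)))]$, where $h(x^n)=(h(x_1),\dots,h(x_n))$.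 Then $R_n=\mathbb{E}[\psi(C(y^n,h^\star(x^n)))]-\mathbb{E}[\psi(C(y^n,\widehat y^n))]$. *)

theory Defs
  imports "HOL-Probability.Probability"
begin

definition one_hot :: "(real^'m) set" where
  "one_hot = range (\<lambda>j. axis j 1)"

definition binary_vectors :: "(real^'m) set" where
  "binary_vectors = {y. \<forall>j. y $ j \<in> {0, 1}}"

definition probability_vectors :: "(real^'m) set" where
  "probability_vectors = {q. (\<forall>j. 0 \<le> q $ j) \<and> (\<Sum>j\<in>UNIV. q $ j) = 1}"

definition unit_box :: "(real^'m) set" where
  "unit_box = {q. \<forall>j. 0 \<le> q $ j \<and> q $ j \<le> 1}"

definition mc_confusion :: "real^'m \<Rightarrow> real^'m \<Rightarrow> real^'m^'m" where
  "mc_confusion y yh = (\<chi> j l. y $ j * yh $ l)"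

text \<open>The two inner indices \<open>u, v \<in> {0, 1}\<close> are represented by the type \<^typ>\<open>bool\<close>.\<close>

definition ml_confusion :: "real^'m \<Rightarrow> real^'m \<Rightarrow> real^bool^bool^'m" where
  "ml_confusion y yh = (\<chi> j u v. of_bool (y $ j = of_bool u) * of_bool (yh $ j = of_bool v))"

text \<open>Everything below is parametric in the single-pair confusion matrix \<open>conf\<close> and in the
  sets \<open>Y\<close> and \<open>Yhat\<close> of label vectors and allowed predictions. On the nested vector types above,
  \<open>norm\<close> and \<open>\<bullet>\<close> are the entrywise Euclidean norm and dot product.\<close>

definition confusion_hull ::
    "(real^'m \<Rightarrow> real^'m \<Rightarrow> 'c::euclidean_space) \<Rightarrow> (real^'m) set \<Rightarrow> (real^'m) set \<Rightarrow> 'c set" where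
  "confusion_hull conf Y Yhat = convex hull {conf y yh | y yh. y \<in> Y \<and> yh \<in> Yhat}"

definition mean_confusion ::
    "(real^'m \<Rightarrow> real^'m \<Rightarrow> 'c::euclidean_space) \<Rightarrow> nat \<Rightarrow> (nat \<Rightarrow> real^'m) \<Rightarrow> (nat \<Rightarrow> real^'m) \<Rightarrow> 'c" where
  "mean_confusion conf n ys yhs = (1 / real n) *\<^sub>R (\<Sum>t=1..n. conf (ys t) (yhs t))"

text \<open>The expectation of \<open>conf y yh\<close> under any distribution of \<open>y\<close> on \<open>Y\<close> with mean \<open>q\<close>; for both
  confusion matrices it depends on the distribution only through \<open>q\<close>.\<close>

definition expected_confusion ::
    "(real^'m \<Rightarrow> real^'m \<Rightarrow> 'c::euclidean_space) \<Rightarrow> (real^'m) set \<Rightarrow> real^'m \<Rightarrow> real^'m \<Rightarrow> 'c" where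
  "expected_confusion conf Y q yh =
    (THE v. \<exists>p :: (real^'m) pmf. set_pmf p \<subseteq> Y \<and> measure_pmf.expectation p (\<lambda>y. y) = q
       \<and> v = measure_pmf.expectation p (\<lambda>y. conf y yh))"

definition closed_concave_on :: "'c::euclidean_space set \<Rightarrow> ('c \<Rightarrow> real) \<Rightarrow> bool" where
  "closed_concave_on S \<psi> \<longleftrightarrow> concave_on S \<psi> \<and> closed (epigraph S (\<lambda>C. - \<psi> C))"

definition grad :: "('c::euclidean_space \<Rightarrow> real) \<Rightarrow> 'c \<Rightarrow> 'c" where
  "grad f C = (THE D. GDERIV f C :> D)"

definition smoothing ::
    "'c::euclidean_space set \<Rightarrow> ('c \<Rightarrow> real) \<Rightarrow> (real \<Rightarrow> 'c \<Rightarrow> real) \<Rightarrow> real \<Rightarrow> real \<Rightarrow> bool" where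
  "smoothing S \<psi> \<Psi> \<alpha> \<beta> \<longleftrightarrow>
    (\<forall>\<gamma>>0. concave_on S (\<Psi> \<gamma>)
       \<and> (\<forall>C\<in>S. 0 \<le> \<psi> C - \<Psi> \<gamma> C \<and> \<psi> C - \<Psi> \<gamma> C \<le> \<alpha> * \<gamma>)
       \<and> (\<exists>U. open U \<and> S \<subseteq> U \<and> \<Psi> \<gamma> differentiable_on U)
       \<and> (\<beta> / \<gamma>)-lipschitz_on S (grad (\<Psi> \<gamma>)))"

definition moreau_smoothing ::
    "'c::euclidean_space set \<Rightarrow> ('c \<Rightarrow> real) \<Rightarrow> real \<Rightarrow> 'c \<Rightarrow> real" where
  "moreau_smoothing S \<psi> \<gamma> C = (SUP C'\<in>S. \<psi> C' - 1 / (2 * \<gamma>) * (norm (C - C'))\<^sup>2)"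

text \<open>\<open>\<eta>\<close> is a version of the conditional expectation of \<open>y\<close> given \<open>x\<close>: componentwise, given the
  \<open>\<sigma>\<close>-algebra generated by the projection \<open>(x, y) \<mapsto> x\<close>.\<close>

definition data_model ::
    "'x measure \<Rightarrow> (real^'m) set \<Rightarrow> ('x \<times> (real^'m)) measure \<Rightarrow> ('x \<Rightarrow> real^'m) \<Rightarrow> bool" where
  "data_model X Y P \<eta> \<longleftrightarrow>
     prob_space P \<and> sets P = sets (X \<Otimes>\<^sub>M count_space Y)
     \<and> \<eta> \<in> borel_measurable X \<and> (\<forall>x\<in>space X. \<eta> x \<in> unit_box)
     \<and> (\<forall>j. AE z in P. \<eta> (fst z) $ j
            = real_cond_exp P (vimage_algebra (space P) fst X) (\<lambda>z. snd z $ j) z)"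

text \<open>The i.i.d. sequence \<open>(x\<^sub>1, y\<^sub>1), \<dots>, (x\<^sub>n, y\<^sub>n)\<close> is the coordinate process \<open>\<omega> 1, \<dots>, \<omega> n\<close> on the
  product space.\<close>

abbreviation iid :: "('x \<times> (real^'m)) measure \<Rightarrow> nat set \<Rightarrow> (nat \<Rightarrow> 'x \<times> (real^'m)) measure" where
  "iid P I \<equiv> PiM I (\<lambda>_. P)"

text \<open>A quantity chosen at trial \<open>t\<close> from the past \<open>w = (x\<^sub>1, y\<^sub>1), \<dots>, (x\<^bsub>t-1\<^esub>, y\<^bsub>t-1\<^esub>)\<close> and the current
  instance \<open>x\<^sub>t\<close> is a function \<open>f t w x\<^sub>t\<close>.\<close>

definition nonanticipating ::
    "'x measure \<Rightarrow> ('x \<times> (real^'m)) measure \<Rightarrow> nat \<Rightarrow> (real^'m) measure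
       \<Rightarrow> (nat \<Rightarrow> (nat \<Rightarrow> 'x \<times> (real^'m)) \<Rightarrow> 'x \<Rightarrow> real^'m) \<Rightarrow> bool" where
  "nonanticipating X P n A f \<longleftrightarrow>
     (\<forall>t\<in>{1..n}. (\<lambda>(w, x). f t w x) \<in> iid P {1..<t} \<Otimes>\<^sub>M X \<rightarrow>\<^sub>M A)"

definition at_trial ::
    "(nat \<Rightarrow> (nat \<Rightarrow> 'x \<times> (real^'m)) \<Rightarrow> 'x \<Rightarrow> real^'m) \<Rightarrow> nat \<Rightarrow> (nat \<Rightarrow> 'x \<times> (real^'m)) \<Rightarrow> real^'m" where
  "at_trial f t \<omega> = f t (restrict \<omega> {1..<t}) (fst (\<omega> t))"

definition estimates ::
    "'x measure \<Rightarrow> ('x \<times> (real^'m)) measure \<Rightarrow> nat \<Rightarrow> (real^'m) set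
       \<Rightarrow> (nat \<Rightarrow> (nat \<Rightarrow> 'x \<times> (real^'m)) \<Rightarrow> 'x \<Rightarrow> real^'m) \<Rightarrow> bool" where
  "estimates X P n Q \<eta>h \<longleftrightarrow> nonanticipating X P n (restrict_space borel Q) \<eta>h"

primrec omma_confusion ::
    "(real^'m \<Rightarrow> real^'m \<Rightarrow> 'c::euclidean_space) \<Rightarrow> 'c
       \<Rightarrow> (nat \<Rightarrow> (nat \<Rightarrow> 'x \<times> (real^'m)) \<Rightarrow> 'x \<Rightarrow> real^'m) \<Rightarrow> (nat \<Rightarrow> 'x \<times> (real^'m)) \<Rightarrow> nat \<Rightarrow> 'c" where
  "omma_confusion conf C0 yh \<omega> 0 = C0"
| "omma_confusion conf C0 yh \<omega> (Suc t) =
     (real t / real (Suc t)) *\<^sub>R omma_confusion conf C0 yh \<omega> t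
     + (1 / real (Suc t)) *\<^sub>R conf (snd (\<omega> (Suc t))) (at_trial yh (Suc t) \<omega>)"

text \<open>\<open>yh\<close> is a sequence of predictions of OMMA run with utility \<open>\<phi>\<close> from \<open>C0\<close>; ties in the
  maximization may be broken arbitrarily (measurably, using only the available information).\<close>

definition omma ::
    "(real^'m \<Rightarrow> real^'m \<Rightarrow> 'c::euclidean_space) \<Rightarrow> (real^'m) set \<Rightarrow> (real^'m) set
       \<Rightarrow> 'x measure \<Rightarrow> ('x \<times> (real^'m)) measure \<Rightarrow> nat \<Rightarrow> ('c \<Rightarrow> real) \<Rightarrow> 'c
       \<Rightarrow> (nat \<Rightarrow> (nat \<Rightarrow> 'x \<times> (real^'m)) \<Rightarrow> 'x \<Rightarrow> real^'m)
       \<Rightarrow> (nat \<Rightarrow> (nat \<Rightarrow> 'x \<times> (real^'m)) \<Rightarrow> 'x \<Rightarrow> real^'m) \<Rightarrow> bool" where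
  "omma conf Y Yhat X P n \<phi> C0 \<eta>h yh \<longleftrightarrow>
     C0 \<in> confusion_hull conf Y Yhat
     \<and> nonanticipating X P n (count_space Yhat) yh
     \<and> (\<forall>\<omega>\<in>space (iid P {1..n}). \<forall>t\<in>{1..n}.
          is_arg_max
            (\<lambda>v. grad \<phi> (omma_confusion conf C0 yh \<omega> (t - 1))
                 \<bullet> expected_confusion conf Y (at_trial \<eta>h t \<omega>) v)
            (\<lambda>v. v \<in> Yhat) (at_trial yh t \<omega>))"

definition classifier_utility ::
    "(real^'m \<Rightarrow> real^'m \<Rightarrow> 'c::euclidean_space) \<Rightarrow> ('x \<times> (real^'m)) measure \<Rightarrow> nat \<Rightarrow> ('c \<Rightarrow> real)
       \<Rightarrow> ('x \<Rightarrow> real^'m) \<Rightarrow> real" where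
  "classifier_utility conf P n \<psi> h =
     (\<integral>\<omega>. \<psi> (mean_confusion conf n (\<lambda>t. snd (\<omega> t)) (\<lambda>t. h (fst (\<omega> t)))) \<partial>iid P {1..n})"

definition online_utility ::
    "(real^'m \<Rightarrow> real^'m \<Rightarrow> 'c::euclidean_space) \<Rightarrow> ('x \<times> (real^'m)) measure \<Rightarrow> nat \<Rightarrow> ('c \<Rightarrow> real)
       \<Rightarrow> (nat \<Rightarrow> (nat \<Rightarrow> 'x \<times> (real^'m)) \<Rightarrow> 'x \<Rightarrow> real^'m) \<Rightarrow> real" where
  "online_utility conf P n \<psi> yh =
     (\<integral>\<omega>. \<psi> (mean_confusion conf n (\<lambda>t. snd (\<omega> t)) (\<lambda>t. at_trial yh t \<omega>)) \<partial>iid P {1..n})"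

definition optimal_classifier ::
    "(real^'m \<Rightarrow> real^'m \<Rightarrow> 'c::euclidean_space) \<Rightarrow> (real^'m) set \<Rightarrow> 'x measure
       \<Rightarrow> ('x \<times> (real^'m)) measure \<Rightarrow> nat \<Rightarrow> ('c \<Rightarrow> real) \<Rightarrow> ('x \<Rightarrow> real^'m) \<Rightarrow> bool" where
  "optimal_classifier conf Yhat X P n \<psi> hstar \<longleftrightarrow>
     is_arg_max (classifier_utility conf P n \<psi>) (\<lambda>h. h \<in> X \<rightarrow>\<^sub>M count_space Yhat) hstar"

definition regret ::
    "(real^'m \<Rightarrow> real^'m \<Rightarrow> 'c::euclidean_space) \<Rightarrow> ('x \<times> (real^'m)) measure \<Rightarrow> nat \<Rightarrow> ('c \<Rightarrow> real)
       \<Rightarrow> ('x \<Rightarrow> real^'m) \<Rightarrow> (nat \<Rightarrow> (nat \<Rightarrow> 'x \<times> (real^'m)) \<Rightarrow> 'x \<Rightarrow> real^'m) \<Rightarrow> real" where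
  "regret conf P n \<psi> hstar yh = classifier_utility conf P n \<psi> hstar - online_utility conf P n \<psi> yh"

definition total_estimation_error ::
    "('x \<times> (real^'m)) measure \<Rightarrow> nat \<Rightarrow> ('x \<Rightarrow> real^'m)
       \<Rightarrow> (nat \<Rightarrow> (nat \<Rightarrow> 'x \<times> (real^'m)) \<Rightarrow> 'x \<Rightarrow> real^'m) \<Rightarrow> real" where
  "total_estimation_error P n \<eta> \<eta>h =
     (\<Sum>t=1..n. \<integral>\<omega>. norm (\<eta> (fst (\<omega> t)) - at_trial \<eta>h t \<omega>) \<partial>iid P {1..n})"

end

theory Submission
  imports Defs
begin

text \<open>Let \<open>\<phi>\<close> be the smooth surrogate, \<open>\<kappa>\<close> the smoothness constant, \<open>C\<^sup>*\<close> the mean confusion matrix of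
  the comparator \<open>h\<close>. Smoothness along \<open>C\<^sub>t - C\<^bsub>t-1\<^esub> = (C(y\<^sub>t, v\<^sub>t) - C\<^bsub>t-1\<^esub>) / t\<close>, the greedy choice of the
  prediction \<open>v\<^sub>t\<close> and concavity (\<open>\<nabla>\<phi>(C) \<bullet> (C\<^sup>* - C) \<ge> \<phi>(C\<^sup>*) - \<phi>(C)\<close>) give, for \<open>r\<^sub>t = \<phi>(C\<^sup>*) - E \<phi>(C\<^sub>t)\<close>,
  \<open>t r\<^sub>t \<le> (t - 1) r\<^bsub>t-1\<^esub> + 2 b L E norm (\<eta> - \<eta>h) + a \<kappa> / t\<close>, where \<open>2 a\<close> bounds the squared diameter of
  the hull. This telescopes into a harmonic sum. Jensen's inequality bounds the utility of \<open>h\<close> by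
  \<open>\<phi>(C\<^sup>*)\<close>, and \<open>\<gamma>\<close> balances the smoothness term against the approximation error of \<open>\<phi>\<close>. The Moreau
  envelope lies above \<open>\<psi>\<close> rather than below it, but only the total width of the approximation matters.\<close>

subsection \<open>Smooth concave functions on a convex set\<close>

text \<open>Three points shape the development. The hull lies in a proper affine subspace, so a
  Lipschitz constant of the surrogate says nothing about its gradient in transversal directions.
  Hence \<open>smooth_concave_on\<close>, the interface shared by both parts, tests gradients only
  against differences of points of the hull, and \<eta> and its estimates have to be kept in the
  convex hull of the labels. No measurability of the utility or of its gradient is assumed. Labels
  and predictions range over finite sets, so every random confusion matrix is a simple function of
  the data, and an arbitrary function of it is integrable. Conditioning on the past is expressed by
  Fubini: coordinate t is integrated innermost with the other coordinates frozen, which turns the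
  gradient into a constant vector. The constants come from the matrices: single-pair matrices have
  nonnegative entries and squared norm a, so their squared distances are at most 2 a, while b bounds
  how far the expected matrix moves when the mean label moves by a unit vector.\<close>

definition smooth_concave_on ::
    "'c::euclidean_space set \<Rightarrow> ('c \<Rightarrow> real) \<Rightarrow> ('c \<Rightarrow> 'c) \<Rightarrow> real \<Rightarrow> real \<Rightarrow> bool" where
  "smooth_concave_on S \<phi> G \<kappa> L \<longleftrightarrow>
     (\<forall>A\<in>S. \<forall>B\<in>S. \<phi> B \<le> \<phi> A + G A \<bullet> (B - A)
        \<and> \<phi> A + G A \<bullet> (B - A) - \<kappa> / 2 * (norm (B - A))\<^sup>2 \<le> \<phi> B)
     \<and> (\<forall>C\<in>S. \<forall>A\<in>S. \<forall>B\<in>S. G C \<bullet> (A - B) \<le> L * norm (A - B))"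

lemma grad_eq: "GDERIV f x :> D \<Longrightarrow> grad f x = D"
proof -
  assume D: "GDERIV f x :> D"
  have "E = D" if "GDERIV f x :> E" for E
  proof -
    have "(\<lambda>h. h \<bullet> E) = (\<lambda>h. h \<bullet> D)"
      using D that has_derivative_unique unfolding gderiv_def by blast
    \<comment> \<open>The two functionals are evaluated at \<open>E - D\<close>, so that the
      difference becomes a squared norm.\<close>
    then have "(E - D) \<bullet> E = (E - D) \<bullet> D" by meson
    then show "E = D" by (metis eq_iff_diff_eq_0 inner_diff_right inner_eq_zero_iff)
  qed
  then show ?thesis unfolding grad_def using D by (intro the_equality)
qed

text \<open>Riesz representation: the functional \<open>f'\<close> is the inner product with
  \<open>adjoint f' 1\<close>.\<close>

lemma differentiable_imp_GDERIV_grad: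
  assumes "f differentiable (at x)"
  shows "GDERIV f x :> grad f x"
proof -
  obtain f' where f': "(f has_derivative f') (at x)"
    using assms by (auto simp: differentiable_def)
  then have "f' = (\<lambda>h. h \<bullet> adjoint f' 1)"
    using adjoint_works[OF has_derivative_linear[OF f'], of _ 1] by auto
  then have "GDERIV f x :> adjoint f' 1"
    using f' unfolding gderiv_def by simp
  then show ?thesis using grad_eq by metis
qed

lemma GDERIV_line:
  assumes "GDERIV f (A + s *\<^sub>R D) :> E"
  shows "((\<lambda>s. f (A + s *\<^sub>R D)) has_real_derivative E \<bullet> D) (at s)"
proof -
  have "((\<lambda>s. A + s *\<^sub>R D) has_derivative (\<lambda>h. h *\<^sub>R D)) (at s)"
    by (auto intro!: derivative_eq_intros)
  from has_derivative_compose[OF this assms[unfolded gderiv_def]]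
  have "((\<lambda>s. f (A + s *\<^sub>R D)) has_derivative (\<lambda>h. (h *\<^sub>R D) \<bullet> E)) (at s)" .
  moreover have "(\<lambda>h. (h *\<^sub>R D) \<bullet> E) = (*) (E \<bullet> D)"
    by (auto simp: inner_commute)
  ultimately show ?thesis
    by (simp add: has_field_derivative_def)
qed

text \<open>Only small positive steps are tested, so the bound can be used at boundary points of a
  set in feasible directions.\<close>

lemma GDERIV_line_le:
  fixes f :: "'c::real_inner \<Rightarrow> real"
  assumes "GDERIV f A :> E" and "e > 0"
    and le: "\<And>s. 0 < s \<Longrightarrow> s < e \<Longrightarrow> f (A + s *\<^sub>R D) \<le> f A + s * K"
  shows "E \<bullet> D \<le> K"
proof -
  have "((\<lambda>s. f (A + s *\<^sub>R D)) has_real_derivative E \<bullet> D) (at 0)"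
    using assms(1) GDERIV_line[of f A 0 D E] by simp
  then have "((\<lambda>h. (f (A + h *\<^sub>R D) - f A) / h) \<longlongrightarrow> E \<bullet> D) (at_right 0)"
    by (simp add: DERIV_def filterlim_at_split)
  moreover have "\<forall>\<^sub>F h in at_right 0. (f (A + h *\<^sub>R D) - f A) / h \<le> K"
    using eventually_at_right_real[OF \<open>e > 0\<close>]
    by eventually_elim (use le in \<open>auto simp: field_simps\<close>)
  ultimately show ?thesis
    by (rule tendsto_upperbound) simp
qed

lemma GDERIV_line_ge:
  fixes f :: "'c::real_inner \<Rightarrow> real"
  assumes "GDERIV f A :> E" and "e > 0"
    and ge: "\<And>s. 0 < s \<Longrightarrow> s < e \<Longrightarrow> f A + s * K \<le> f (A + s *\<^sub>R D)"
  shows "K \<le> E \<bullet> D"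
proof -
  have "GDERIV (\<lambda>x. - f x) A :> - E" by (rule GDERIV_minus) fact
  from GDERIV_line_le[OF this \<open>e > 0\<close>, of D "-K"] show ?thesis
    using ge by fastforce
qed

text \<open>A concave function lies above its chord, so its one-sided derivative towards
  \<open>B\<close> is at least the chord slope \<open>f B - f A\<close>.\<close>

lemma concave_on_le_tangent:
  assumes "concave_on S f" "A \<in> S" "B \<in> S" "GDERIV f A :> E"
  shows "f B \<le> f A + E \<bullet> (B - A)"
proof -
  have "f B - f A \<le> E \<bullet> (B - A)"
  proof (rule GDERIV_line_ge[OF assms(4), of 1])
    fix s :: real assume "0 < s" "s < 1"
    then have "(1 - s) * f A + s * f B \<le> f ((1 - s) *\<^sub>R A + s *\<^sub>R B)"
      using assms(1-3) unfolding concave_on_iff by simp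
    then show "f A + s * (f B - f A) \<le> f (A + s *\<^sub>R (B - A))"
      by (simp add: algebra_simps)
  qed simp
  then show ?thesis by simp
qed

text \<open>The gradient is Lipschitz only on \<open>S\<close>, so the argument stays on the segment
  from \<open>A\<close> to \<open>B\<close>.\<close>

lemma lipschitz_gradient_descent:
  fixes f :: "'c::euclidean_space \<Rightarrow> real"
  assumes "convex S" "A \<in> S" "B \<in> S" and G: "\<And>C. C \<in> S \<Longrightarrow> GDERIV f C :> G C"
    and lip: "\<kappa>-lipschitz_on S G"
  shows "f A + G A \<bullet> (B - A) - \<kappa> / 2 * (norm (B - A))\<^sup>2 \<le> f B"
proof -
  define D where "D = B - A"
  \<comment> \<open>Gap between \<open>f\<close> and its quadratic minorant, up to a constant; the
    Lipschitz bound makes its derivative nonnegative.\<close>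
  define h where "h s = f (A + s *\<^sub>R D) - s * (G A \<bullet> D) + \<kappa> / 2 * s\<^sup>2 * (norm D)\<^sup>2" for s
  have "h 0 \<le> h 1"
  proof (rule DERIV_nonneg_imp_nondecreasing[where f = h])
    fix s :: real assume s: "0 \<le> s" "s \<le> 1"
    have "(1 - s) *\<^sub>R A + s *\<^sub>R B \<in> S"
      using s assms(1-3) by (auto simp: convex_def)
    then have inS: "A + s *\<^sub>R D \<in> S" by (simp add: D_def algebra_simps)
    let ?E = "G (A + s *\<^sub>R D)"
    have "(h has_real_derivative ?E \<bullet> D - G A \<bullet> D + \<kappa> * s * (norm D)\<^sup>2) (at s)"
      unfolding h_def using GDERIV_line[OF G[OF inS]]
      by (auto intro!: derivative_eq_intros)
    moreover have "\<bar>(?E - G A) \<bullet> D\<bar> \<le> \<kappa> * s * (norm D)\<^sup>2"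
    proof -
      have "norm (?E - G A) \<le> \<kappa> * (s * norm D)"
        using lipschitz_onD[OF lip inS assms(2)] s by (simp add: dist_norm)
      then have "norm (?E - G A) * norm D \<le> \<kappa> * (s * norm D) * norm D"
        by (rule mult_right_mono) simp
      then show ?thesis
        using Cauchy_Schwarz_ineq2[of "?E - G A" D] by (simp add: power2_eq_square mult.assoc)
    qed
    ultimately show "\<exists>y. DERIV h s :> y \<and> 0 \<le> y"
      by (intro exI conjI) (assumption, simp add: inner_diff_left)
  qed simp
  then show ?thesis by (simp add: h_def D_def)
qed

text \<open>Only differences inside \<open>S\<close> are controlled: the gradient may be large in directions transversal
  to the affine hull of \<open>S\<close>. At a boundary point \<open>C\<close> the direction \<open>A - B\<close> need not be feasible,
  so the bound is first obtained at points of \<open>S\<close> moved towards the midpoint of \<open>A\<close> and \<open>B\<close>.\<close>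

lemma lipschitz_directional_bound:
  fixes f :: "'c::euclidean_space \<Rightarrow> real"
  assumes "convex S" "A \<in> S" "B \<in> S" "C \<in> S" and G: "\<And>C. C \<in> S \<Longrightarrow> GDERIV f C :> G C"
    and cont: "continuous_on S G" and lip: "L-lipschitz_on S f"
  shows "G C \<bullet> (A - B) \<le> L * norm (A - B)"
proof -
  \<comment> \<open>Moving \<open>C\<close> by the fraction \<open>e\<close> towards the midpoint
    leaves room \<open>e / 2\<close> in direction \<open>A - B\<close>: the shifted point is
    \<open>1 - e\<close> times \<open>C\<close> plus \<open>e\<close> times a point of the segment
    between \<open>A\<close> and \<open>B\<close>.\<close>
  define M where "M e = C + e *\<^sub>R ((1/2) *\<^sub>R (A + B) - C)" for e :: real
  have mid: "(1/2 + r) *\<^sub>R A + (1/2 - r) *\<^sub>R B \<in> S" if "0 \<le> r" "r \<le> 1/2" for r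
    using assms(1-3) that by (auto simp: convex_def)
  have inS: "M e + s *\<^sub>R (A - B) \<in> S" if "0 < e" "e \<le> 1" "0 \<le> s" "s \<le> e / 2" for e s
  proof -
    have "(1 - e) *\<^sub>R C + e *\<^sub>R ((1/2 + s/e) *\<^sub>R A + (1/2 - s/e) *\<^sub>R B) \<in> S"
      using that by (intro convexD assms mid) (auto simp: field_simps)
    also have "(1 - e) *\<^sub>R C + e *\<^sub>R ((1/2 + s/e) *\<^sub>R A + (1/2 - s/e) *\<^sub>R B) = M e + s *\<^sub>R (A - B)"
    proof -
      have "e * (1/2 + s/e) = e/2 + s" "e * (1/2 - s/e) = e/2 - s"
        using that by (auto simp: field_simps)
      then show ?thesis
        unfolding M_def scaleR_add_right scaleR_scaleR by (simp add: algebra_simps)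
    qed
    finally show ?thesis .
  qed
  have MS: "M e \<in> S" if "0 < e" "e \<le> 1" for e using inS[of e 0] that by simp
  have bnd: "G (M e) \<bullet> (A - B) \<le> L * norm (A - B)" if e: "0 < e" "e \<le> 1" for e
  proof (rule GDERIV_line_le[OF G[OF MS[OF e]], of "e/2"])
    fix s :: real assume s: "0 < s" "s < e / 2"
    have "\<bar>f (M e + s *\<^sub>R (A - B)) - f (M e)\<bar> \<le> L * (s * norm (A - B))"
      using lipschitz_onD[OF lip inS[of e s] MS[OF e]] e s by (simp add: dist_norm)
    then show "f (M e + s *\<^sub>R (A - B)) \<le> f (M e) + s * (L * norm (A - B))"
      by (simp add: mult.left_commute)
  qed (use e in simp)
  have "((\<lambda>e. G (M e)) \<longlongrightarrow> G C) (at_right 0)"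
  proof (rule continuous_on_tendsto_compose[OF cont _ \<open>C \<in> S\<close>])
    have "((\<lambda>e. M e) \<longlongrightarrow> C + 0 *\<^sub>R ((1/2) *\<^sub>R (A + B) - C)) (at_right 0)"
      unfolding M_def by (intro tendsto_intros)
    then show "(M \<longlongrightarrow> C) (at_right 0)" by simp
    show "\<forall>\<^sub>F e in at_right 0. M e \<in> S"
      using eventually_at_right_real[of 0 "1::real"] by (auto elim!: eventually_mono intro!: MS)
  qed
  then have "((\<lambda>e. G (M e) \<bullet> (A - B)) \<longlongrightarrow> G C \<bullet> (A - B)) (at_right 0)"
    by (intro tendsto_intros)
  moreover have "\<forall>\<^sub>F e in at_right 0. G (M e) \<bullet> (A - B) \<le> L * norm (A - B)"
    using eventually_at_right_real[of 0 "1::real"] by (auto elim!: eventually_mono intro!: bnd)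
  ultimately show ?thesis by (rule tendsto_upperbound) simp
qed

lemma smoothing_smooth_concave_on:
  assumes "smoothing S \<psi> \<Psi> \<alpha> \<beta>" "\<gamma> > 0" "L-lipschitz_on S (\<Psi> \<gamma>)"
  shows "smooth_concave_on S (\<Psi> \<gamma>) (grad (\<Psi> \<gamma>)) (\<beta> / \<gamma>) L"
proof -
  obtain U where conc: "concave_on S (\<Psi> \<gamma>)" and U: "open U" "S \<subseteq> U" "\<Psi> \<gamma> differentiable_on U"
    and lip: "(\<beta> / \<gamma>)-lipschitz_on S (grad (\<Psi> \<gamma>))"
    using assms(1,2) unfolding smoothing_def by blast
  have G: "GDERIV (\<Psi> \<gamma>) C :> grad (\<Psi> \<gamma>) C" if "C \<in> S" for C
    using U that differentiable_on_eq_differentiable_at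
    by (intro differentiable_imp_GDERIV_grad) blast
  have S: "convex S" using conc by (simp add: concave_on_iff)
  show ?thesis
    unfolding smooth_concave_on_def
    by (intro conjI ballI concave_on_le_tangent[OF conc _ _ G] lipschitz_gradient_descent[OF S _ _ G lip]
      lipschitz_directional_bound[OF S _ _ _ G lipschitz_on_continuous_on[OF lip] assms(3)])
qed

text \<open>Divide by \<open>s\<close> and let \<open>s\<close> tend to 0: the form in which
  first-order optimality of the proximal point is extracted.\<close>

lemma le_of_scaled_quadratic:
  fixes a b c :: real
  assumes "\<And>s. 0 < s \<Longrightarrow> s < 1 \<Longrightarrow> s * a \<le> s * b + s\<^sup>2 * c"
  shows "a \<le> b"
proof -
  have "((\<lambda>s. b + s * c) \<longlongrightarrow> b + 0 * c) (at_right 0)" by (intro tendsto_intros)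
  moreover have "\<forall>\<^sub>F s in at_right 0. a \<le> b + s * c"
    using eventually_at_right_real[OF zero_less_one]
  proof eventually_elim
    case (elim s)
    then have "s * a \<le> s * (b + s * c)"
      using assms[of s] by (simp add: power2_eq_square algebra_simps)
    then show ?case using elim by simp
  qed
  ultimately show ?thesis
    using tendsto_lowerbound[of "\<lambda>s. b + s * c" "b + 0 * c" "at_right 0" a] by simp
qed

subsection \<open>The Moreau envelope\<close>

locale moreau =
  fixes S :: "'c::euclidean_space set" and \<psi> :: "'c \<Rightarrow> real" and \<gamma> L :: real
  assumes S: "compact S" "S \<noteq> {}" and concave: "concave_on S \<psi>"
    and lip: "L-lipschitz_on S \<psi>" and gamma: "\<gamma> > 0"
begin

definition prox :: "'c \<Rightarrow> 'c" where
  "prox C = (SOME P. P \<in> S \<and> (\<forall>Z\<in>S. \<psi> Z - 1 / (2 * \<gamma>) * (norm (C - Z))\<^sup>2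
     \<le> \<psi> P - 1 / (2 * \<gamma>) * (norm (C - P))\<^sup>2))"

text \<open>The Lipschitz condition makes \<psi> continuous up to the boundary of the compact set
  \<open>S\<close>, so the penalized maximum is attained.\<close>

lemma prox_in: "prox C \<in> S"
  and prox_max: "Z \<in> S \<Longrightarrow> \<psi> Z - 1 / (2 * \<gamma>) * (norm (C - Z))\<^sup>2
     \<le> \<psi> (prox C) - 1 / (2 * \<gamma>) * (norm (C - prox C))\<^sup>2"
proof -
  have "continuous_on S (\<lambda>Z. \<psi> Z - 1 / (2 * \<gamma>) * (norm (C - Z))\<^sup>2)"
    by (intro continuous_intros lipschitz_on_continuous_on[OF lip])
  from continuous_attains_sup[OF S this]
  have "\<exists>P. P \<in> S \<and> (\<forall>Z\<in>S. \<psi> Z - 1 / (2 * \<gamma>) * (norm (C - Z))\<^sup>2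
     \<le> \<psi> P - 1 / (2 * \<gamma>) * (norm (C - P))\<^sup>2)" by blast
  from someI_ex[OF this, folded prox_def]
  show "prox C \<in> S" and "Z \<in> S \<Longrightarrow> \<psi> Z - 1 / (2 * \<gamma>) * (norm (C - Z))\<^sup>2
     \<le> \<psi> (prox C) - 1 / (2 * \<gamma>) * (norm (C - prox C))\<^sup>2" by blast+
qed

lemma moreau_eq:
  "moreau_smoothing S \<psi> \<gamma> C = \<psi> (prox C) - 1 / (2 * \<gamma>) * (norm (C - prox C))\<^sup>2"
  unfolding moreau_smoothing_def
proof (rule cSup_eq_maximum)
  show "\<psi> (prox C) - 1 / (2 * \<gamma>) * (norm (C - prox C))\<^sup>2
      \<in> (\<lambda>C'. \<psi> C' - 1 / (2 * \<gamma>) * (norm (C - C'))\<^sup>2) ` S"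
    using prox_in by (rule imageI)
qed (use prox_max in blast)

text \<open>The derivative of the penalty in \<open>C\<close> with the maximizer held fixed, as in
  the envelope theorem; \<open>grad_moreau\<close> identifies it with the true gradient.\<close>

definition moreau_grad :: "'c \<Rightarrow> 'c" where
  "moreau_grad C = (1 / \<gamma>) *\<^sub>R (prox C - C)"

lemma segment:
  assumes "Z \<in> S" "0 \<le> s" "s \<le> 1"
  shows "prox C + s *\<^sub>R (Z - prox C) \<in> S"
    and "(1 - s) * \<psi> (prox C) + s * \<psi> Z \<le> \<psi> (prox C + s *\<^sub>R (Z - prox C))"
proof -
  have "prox C + s *\<^sub>R (Z - prox C) = (1 - s) *\<^sub>R prox C + s *\<^sub>R Z" by (simp add: algebra_simps)
  moreover have "convex S" using concave by (simp add: concave_on_iff)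
  ultimately show "prox C + s *\<^sub>R (Z - prox C) \<in> S"
      "(1 - s) * \<psi> (prox C) + s * \<psi> Z \<le> \<psi> (prox C + s *\<^sub>R (Z - prox C))"
    using assms concave_onD[OF concave, of s "prox C" Z] prox_in[of C]
    by (simp_all add: convexD)
qed

lemma norm_sq_step:
  "(norm (C - (P + s *\<^sub>R D)))\<^sup>2 = (norm (C - P))\<^sup>2 - 2 * s * ((C - P) \<bullet> D) + s\<^sup>2 * (norm D)\<^sup>2"
  for C P D :: 'c
  unfolding power2_norm_eq_inner by (simp add: algebra_simps inner_commute power2_eq_square)

lemma inner_moreau_grad: "moreau_grad C \<bullet> D = - ((C - prox C) \<bullet> D) / \<gamma>"
  by (simp add: moreau_grad_def inner_diff_left)

text \<open>Maximality of \<open>prox C\<close> against the points of the segment towards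
  \<open>Z\<close>, with the penalty expanded in \<open>s\<close>.\<close>

lemma segment_max:
  assumes "Z \<in> S" "0 \<le> s" "s \<le> 1"
  shows "\<psi> (prox C + s *\<^sub>R (Z - prox C))
     \<le> \<psi> (prox C) + s * (moreau_grad C \<bullet> (Z - prox C)) + s\<^sup>2 * ((norm (Z - prox C))\<^sup>2 / (2 * \<gamma>))"
proof -
  let ?D = "Z - prox C"
  have "1 / (2 * \<gamma>) * (norm (C - (prox C + s *\<^sub>R ?D)))\<^sup>2
      = 1 / (2 * \<gamma>) * (norm (C - prox C))\<^sup>2 + s * (moreau_grad C \<bullet> ?D)
        + s\<^sup>2 * ((norm ?D)\<^sup>2 / (2 * \<gamma>))"
    unfolding norm_sq_step inner_moreau_grad
    by (simp add: right_diff_distrib distrib_left)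
  then show ?thesis
    using prox_max[OF segment(1)[OF assms], of C C] by linarith
qed

text \<open>First-order optimality of the proximal point: \<open>moreau_grad C\<close> is a
  supergradient of \<psi> at \<open>prox C\<close> relative to \<open>S\<close>.\<close>

lemma prox_variational:
  assumes "Z \<in> S"
  shows "\<psi> Z - \<psi> (prox C) \<le> moreau_grad C \<bullet> (Z - prox C)"
proof (rule le_of_scaled_quadratic)
  fix s :: real assume "0 < s" "s < 1"
  with segment_max[OF assms, of s C] segment(2)[OF assms, of s C]
  show "s * (\<psi> Z - \<psi> (prox C)) \<le> s * (moreau_grad C \<bullet> (Z - prox C))
      + s\<^sup>2 * ((norm (Z - prox C))\<^sup>2 / (2 * \<gamma>))"
    by (simp add: algebra_simps)
qed

text \<open>For \<open>C\<close> in \<open>S\<close> the move from \<open>prox C\<close> back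
  towards \<open>C\<close> is feasible. To first order it saves
  \<open>s * d\<^sup>2 / \<gamma>\<close> of penalty, where \<open>d\<close> is the distance from
  \<open>C\<close> to \<open>prox C\<close>, and costs at most \<open>s * L * d\<close> in \<psi>;
  optimality forces \<open>d / \<gamma> \<le> L\<close>.\<close>

lemma norm_moreau_grad_le:
  assumes "C \<in> S"
  shows "norm (moreau_grad C) \<le> L"
proof -
  let ?d = "norm (C - prox C)"
  have "?d\<^sup>2 / \<gamma> \<le> L * ?d"
  proof (rule le_of_scaled_quadratic)
    fix s :: real assume s: "0 < s" "s < 1"
    have "\<bar>\<psi> (prox C) - \<psi> (prox C + s *\<^sub>R (C - prox C))\<bar> \<le> L * (s * ?d)"
      using lipschitz_onD[OF lip prox_in segment(1)[OF assms], of s C C] s by (simp add: dist_norm)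
    moreover have "moreau_grad C \<bullet> (C - prox C) = - (?d\<^sup>2 / \<gamma>)"
      by (simp add: inner_moreau_grad power2_norm_eq_inner)
    ultimately show "s * (?d\<^sup>2 / \<gamma>) \<le> s * (L * ?d) + s\<^sup>2 * (?d\<^sup>2 / (2 * \<gamma>))"
      using segment_max[OF assms, of s C] s by (simp only: mult_minus_right mult.left_commute[of L])
        linarith
  qed
  then have "?d * (?d / \<gamma>) \<le> ?d * L" by (simp add: power2_eq_square algebra_simps)
  then have "?d / \<gamma> \<le> L"
    using lipschitz_on_nonneg[OF lip] mult_le_cancel_left_pos[of ?d "?d / \<gamma>" L]
    by (cases "?d = 0") (simp, metis norm_ge_zero order_le_less)
  then show ?thesis using gamma by (simp add: moreau_grad_def norm_minus_commute)
qed

text \<open>The supergradient inequality at \<open>prox A\<close> is tested at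
  \<open>prox B\<close>; completing the square leaves the surplus
  \<open>(norm (u - v))\<^sup>2 / (2 * \<gamma>)\<close>, which is dropped.\<close>

lemma moreau_le_tangent:
  "moreau_smoothing S \<psi> \<gamma> B \<le> moreau_smoothing S \<psi> \<gamma> A + moreau_grad A \<bullet> (B - A)"
proof -
  define u v where uv: "u = prox A - A" "v = prox B - B"
  have "2 * (u \<bullet> (prox B - prox A)) - (norm v)\<^sup>2 + (norm u)\<^sup>2 + (norm (u - v))\<^sup>2
      = 2 * (u \<bullet> (B - A))"
  proof -
    have "prox B - prox A = (v - u) + (B - A)" by (simp add: uv)
    then show ?thesis
      unfolding power2_norm_eq_inner by (simp add: inner_add_right inner_diff inner_commute)
  qed
  then have "1 / (2 * \<gamma>) * (2 * (u \<bullet> (prox B - prox A)) - (norm v)\<^sup>2 + (norm u)\<^sup>2 + (norm (u - v))\<^sup>2)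
      = 1 / (2 * \<gamma>) * (2 * (u \<bullet> (B - A)))"
    by (rule arg_cong)
  then have "1 / \<gamma> * (u \<bullet> (prox B - prox A)) - 1 / (2 * \<gamma>) * (norm (B - prox B))\<^sup>2
      + 1 / (2 * \<gamma>) * (norm (A - prox A))\<^sup>2 + 1 / (2 * \<gamma>) * (norm (u - v))\<^sup>2
      = moreau_grad A \<bullet> (B - A)"
    by (simp add: moreau_grad_def uv[symmetric] norm_minus_commute[of A] norm_minus_commute[of B]
        right_diff_distrib distrib_left)
  moreover have "\<psi> (prox B) \<le> \<psi> (prox A) + (1 / \<gamma>) * (u \<bullet> (prox B - prox A))"
    using prox_variational[OF prox_in, of B A] by (simp add: moreau_grad_def uv)
  moreover have "0 \<le> 1 / (2 * \<gamma>) * (norm (u - v))\<^sup>2" using gamma by simp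
  ultimately show ?thesis unfolding moreau_eq by linarith
qed

text \<open>\<open>prox A\<close> is a candidate in the supremum that defines the value at
  \<open>B\<close>; expanding its penalty gives exactly the quadratic minorant.\<close>

lemma moreau_ge_tangent:
  "moreau_smoothing S \<psi> \<gamma> A + moreau_grad A \<bullet> (B - A) - 1 / (2 * \<gamma>) * (norm (B - A))\<^sup>2
     \<le> moreau_smoothing S \<psi> \<gamma> B"
proof -
  have "(norm (B - prox A))\<^sup>2 = (norm (A - prox A))\<^sup>2 + 2 * ((A - prox A) \<bullet> (B - A)) + (norm (B - A))\<^sup>2"
    using dot_norm[of "A - prox A" "B - A"] by simp
  then have "1 / (2 * \<gamma>) * (norm (B - prox A))\<^sup>2 = 1 / (2 * \<gamma>) * (norm (A - prox A))\<^sup>2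
      - moreau_grad A \<bullet> (B - A) + 1 / (2 * \<gamma>) * (norm (B - A))\<^sup>2"
    by (simp add: inner_moreau_grad distrib_left)
  then show ?thesis using prox_max[OF prox_in, of A B] unfolding moreau_eq by linarith
qed

text \<open>The two tangent bounds hold on the whole space and squeeze the first-order remainder
  between 0 and a multiple of the squared distance, so differentiability follows at boundary points
  of \<open>S\<close> as well.\<close>

lemma grad_moreau: "grad (moreau_smoothing S \<psi> \<gamma>) = moreau_grad"
proof
  fix A
  let ?F = "moreau_smoothing S \<psi> \<gamma>" and ?G = "moreau_grad A"
  have "GDERIV ?F A :> ?G"
    unfolding gderiv_def has_derivative_at2
  proof (intro conjI bounded_linear_inner_left)
    have bnd: "norm ((1 / norm (y - A)) *\<^sub>R (?F y - (?F A + (y - A) \<bullet> ?G)))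
        \<le> 1 / (2 * \<gamma>) * norm (y - A)" for y
    proof (cases "y = A")
      case False
      have "\<bar>?F y - (?F A + (y - A) \<bullet> ?G)\<bar> \<le> 1 / (2 * \<gamma>) * (norm (y - A))\<^sup>2"
        using moreau_le_tangent[of y A] moreau_ge_tangent[of A y]
        unfolding inner_commute[of "y - A"] by linarith
      then have "\<bar>?F y - (?F A + (y - A) \<bullet> ?G)\<bar> / norm (y - A)
          \<le> 1 / (2 * \<gamma>) * (norm (y - A))\<^sup>2 / norm (y - A)"
        by (rule divide_right_mono) simp
      then show ?thesis using False by (simp add: power2_eq_square)
    qed simp
    have "((\<lambda>y. 1 / (2 * \<gamma>) * norm (y - A)) \<longlongrightarrow> 1 / (2 * \<gamma>) * norm (A - A)) (at A)"
      by (intro tendsto_intros)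
    then have "((\<lambda>y. 1 / (2 * \<gamma>) * norm (y - A)) \<longlongrightarrow> 0) (at A)" by simp
    from Lim_null_comparison[OF always_eventually[OF allI[OF bnd]] this]
    show "((\<lambda>y. (1 / norm (y - A)) *\<^sub>R (?F y - (?F A + (y - A) \<bullet> ?G))) \<longlongrightarrow> 0) (at A)" .
  qed
  then show "grad ?F A = ?G" by (rule grad_eq)
qed

lemma moreau_smooth_concave_on:
  "smooth_concave_on S (moreau_smoothing S \<psi> \<gamma>) (grad (moreau_smoothing S \<psi> \<gamma>)) (1 / \<gamma>) L"
  unfolding smooth_concave_on_def grad_moreau
proof (intro conjI ballI)
  fix C A B assume "C \<in> S"
  then have "moreau_grad C \<bullet> (A - B) \<le> L * norm (A - B)"
    using norm_cauchy_schwarz[of "moreau_grad C" "A - B"]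
      mult_right_mono[OF norm_moreau_grad_le, of C "norm (A - B)"] by simp
  then show "moreau_grad C \<bullet> (A - B) \<le> L * norm (A - B)" .
next
  fix A B
  show "moreau_smoothing S \<psi> \<gamma> B \<le> moreau_smoothing S \<psi> \<gamma> A + moreau_grad A \<bullet> (B - A)"
    by (rule moreau_le_tangent)
  have "1 / \<gamma> / 2 = 1 / (2 * \<gamma>)" by simp
  then show "moreau_smoothing S \<psi> \<gamma> A + moreau_grad A \<bullet> (B - A) - 1 / \<gamma> / 2 * (norm (B - A))\<^sup>2
      \<le> moreau_smoothing S \<psi> \<gamma> B"
    using moreau_ge_tangent[of A B] by (simp only:)
qed

lemma moreau_ge: "C \<in> S \<Longrightarrow> \<psi> C \<le> moreau_smoothing S \<psi> \<gamma> C"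
  using prox_max[of C C] by (simp add: moreau_eq)

text \<open>With \<open>d\<close> the distance from \<open>C\<close> to \<open>prox C\<close>, the
  excess is at most \<open>L * d - d\<^sup>2 / (2 * \<gamma>)\<close>, whose maximum over
  \<open>d\<close> is attained at \<open>d = L * \<gamma>\<close>.\<close>

lemma moreau_le:
  assumes "C \<in> S"
  shows "moreau_smoothing S \<psi> \<gamma> C \<le> \<psi> C + L\<^sup>2 * \<gamma> / 2"
proof -
  let ?d = "norm (C - prox C)"
  have "\<psi> (prox C) \<le> \<psi> C + L * ?d"
    using lipschitz_onD[OF lip assms prox_in, of C] by (simp add: dist_norm)
  moreover have "L * ?d - 1 / (2 * \<gamma>) * ?d\<^sup>2 = L\<^sup>2 * \<gamma> / 2 - 1 / (2 * \<gamma>) * (L * \<gamma> - ?d)\<^sup>2"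
    using gamma by (simp add: power2_diff power_mult_distrib right_diff_distrib distrib_left)
      (simp add: power2_eq_square)
  moreover have "0 \<le> 1 / (2 * \<gamma>) * (L * \<gamma> - ?d)\<^sup>2" using gamma by simp
  ultimately show ?thesis unfolding moreau_eq by linarith
qed

end

subsection \<open>Simple functions and expectations\<close>

lemma measurable_imp_simple_function:
  assumes "f \<in> M \<rightarrow>\<^sub>M count_space A" "finite A"
  shows "simple_function M f"
  unfolding simple_function_eq_measurable
proof
  show "finite (f ` space M)"
    by (rule finite_subset[OF _ assms(2)]) (use measurable_space[OF assms(1)] in auto)
  show "f \<in> M \<rightarrow>\<^sub>M count_space UNIV"
    using measurable_compose[OF assms(1), of "\<lambda>x. x" "count_space UNIV"] by simp
qed

lemma simple_function_measurable_compose: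
  assumes "simple_function N f" "g \<in> M \<rightarrow>\<^sub>M N"
  shows "simple_function M (\<lambda>x. f (g x))"
  unfolding simple_function_eq_measurable
proof
  show "finite ((\<lambda>x. f (g x)) ` space M)"
    by (rule finite_subset[OF _ simple_functionD(1)[OF assms(1)]])
      (use measurable_space[OF assms(2)] in auto)
  show "(\<lambda>x. f (g x)) \<in> M \<rightarrow>\<^sub>M count_space UNIV"
    using measurable_compose[OF assms(2) measurable_simple_function[OF assms(1)]] .
qed

lemma simple_function_bounded:
  fixes f :: "'a \<Rightarrow> 'b::real_normed_vector"
  assumes "simple_function M f"
  obtains B where "B \<ge> 0" "\<And>x. x \<in> space M \<Longrightarrow> norm (f x) \<le> B"
proof -
  have "bounded (f ` space M)"
    using simple_functionD(1)[OF assms] by (rule finite_imp_bounded)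
  then obtain B where "\<forall>x\<in>space M. norm (f x) \<le> B" unfolding bounded_iff by auto
  then show ?thesis by (intro that[of "max B 0"]) (auto simp: le_max_iff_disj)
qed

lemma (in finite_measure) simple_function_integrable:
  fixes f :: "'a \<Rightarrow> 'b::{banach, second_countable_topology}"
  assumes "simple_function M f"
  shows "integrable M f"
proof -
  obtain B where "B \<ge> 0" "\<And>x. x \<in> space M \<Longrightarrow> norm (f x) \<le> B"
    using simple_function_bounded[OF assms] by blast
  then show ?thesis
    by (intro integrable_const_bound[where B = B]) (auto intro: borel_measurable_simple_function assms)
qed

text \<open>Otherwise a hyperplane separates the integral strictly from \<open>S\<close>, and
  integrating the separating functional contradicts this.\<close>

lemma (in prob_space) integral_in_closed_convex:
  fixes f :: "'a \<Rightarrow> 'b::euclidean_space"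
  assumes "convex S" "closed S" "integrable M f" "\<And>x. x \<in> space M \<Longrightarrow> f x \<in> S"
  shows "integral\<^sup>L M f \<in> S"
proof (rule ccontr)
  assume "integral\<^sup>L M f \<notin> S"
  then obtain c d where cd: "c \<bullet> integral\<^sup>L M f < d" "\<forall>x\<in>S. c \<bullet> x > d"
    using separating_hyperplane_closed_point assms(1,2) by blast
  have "d \<le> (\<integral>x. c \<bullet> f x \<partial>M)"
    using assms(3,4) cd(2) by (intro integral_ge_const AE_I2) (auto intro: less_imp_le)
  then show False using cd(1) assms(3) by simp
qed

text \<open>The increment uses \<open>ln x \<le> x - 1\<close> at
  \<open>x = n / (n + 1)\<close>.\<close>

lemma sum_inverse_le_ln:
  assumes "n \<ge> 1"
  shows "(\<Sum>t=1..n. 1 / real t) \<le> 1 + ln (real n)"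
  using assms
proof (induction n rule: dec_induct)
  case (step n)
  have "ln (real n / real (Suc n)) \<le> real n / real (Suc n) - 1"
    using step by (intro ln_le_minus_one) auto
  also have "\<dots> = - (1 / real (Suc n))" by (simp add: field_simps)
  finally have "1 / real (Suc n) \<le> ln (real (Suc n)) - ln (real n)"
    using step by (simp add: ln_div)
  then show ?case using step by simp
qed simp

subsection \<open>Confusion matrices that are affine in the label\<close>

text \<open>On the finite label set \<open>conf\<close> is affine in \<open>y\<close>; the
  right-hand side \<open>off v + lin v q\<close> extends it to mean labels \<open>q\<close>. Both
  settings are treated through this common form.\<close>

locale affine_confusion =
  fixes conf :: "real^'m \<Rightarrow> real^'m \<Rightarrow> 'c::euclidean_space"
    and Y Yhat :: "(real^'m) set"
    and off :: "real^'m \<Rightarrow> 'c" and lin :: "real^'m \<Rightarrow> real^'m \<Rightarrow> 'c"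
    and a b :: real
  assumes finite_Y: "finite Y" and finite_Yhat: "finite Yhat"
    and conf_eq: "y \<in> Y \<Longrightarrow> v \<in> Yhat \<Longrightarrow> conf y v = off v + lin v y"
    and linear_lin: "v \<in> Yhat \<Longrightarrow> linear (lin v)"
    and norm_lin_le: "v \<in> Yhat \<Longrightarrow> norm (lin v q) \<le> b * norm q"
    and norm_conf_diff: "y \<in> Y \<Longrightarrow> v \<in> Yhat \<Longrightarrow> y' \<in> Y \<Longrightarrow> v' \<in> Yhat
      \<Longrightarrow> (norm (conf y v - conf y' v'))\<^sup>2 \<le> 2 * a"
    and a_pos: "a > 0" and b_nonneg: "b \<ge> 0"
begin

lemma a_nonneg: "a \<ge> 0"
  using a_pos by simp

abbreviation S :: "'c set" where "S \<equiv> confusion_hull conf Y Yhat"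

lemma convex_S: "convex S"
  by (simp add: confusion_hull_def)

lemma compact_S: "compact S"
proof -
  have "{conf y yh | y yh. y \<in> Y \<and> yh \<in> Yhat} = (\<lambda>(y, yh). conf y yh) ` (Y \<times> Yhat)" by auto
  then have "finite {conf y yh | y yh. y \<in> Y \<and> yh \<in> Yhat}" using finite_Y finite_Yhat by simp
  then show ?thesis unfolding confusion_hull_def by (rule finite_imp_compact_convex_hull)
qed

lemma conf_in_S: "y \<in> Y \<Longrightarrow> v \<in> Yhat \<Longrightarrow> conf y v \<in> S"
  unfolding confusion_hull_def by (rule hull_inc) auto

text \<open>Balls are convex, so a bound on vertices passes to the hull: once in the second argument
  with a vertex as centre, once more with \<open>A\<close> as centre.\<close>

lemma norm_diff_S:
  assumes "A \<in> S" "B \<in> S"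
  shows "(norm (A - B))\<^sup>2 \<le> 2 * a"
proof -
  have "conf y v \<in> cball (conf y' v') (sqrt (2 * a))"
    if "y \<in> Y" "v \<in> Yhat" "y' \<in> Y" "v' \<in> Yhat" for y v y' v'
    using norm_conf_diff[OF that] by (simp add: real_le_rsqrt dist_norm norm_minus_commute)
  then have "S \<subseteq> cball (conf y' v') (sqrt (2 * a))" if "y' \<in> Y" "v' \<in> Yhat" for y' v'
    unfolding confusion_hull_def using that by (intro hull_minimal) auto
  then have "conf y v \<in> cball A (sqrt (2 * a))" if "y \<in> Y" "v \<in> Yhat" for y v
    using that assms(1) by (metis dist_commute mem_cball subsetD)
  then have "S \<subseteq> cball A (sqrt (2 * a))"
    unfolding confusion_hull_def by (intro hull_minimal) auto
  then have "norm (A - B) \<le> sqrt (2 * a)" using assms(2) by (auto simp: dist_norm)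
  from power_mono[OF this, of 2] show ?thesis using a_nonneg by simp
qed

text \<open>Preimages of convex sets under affine maps are convex, and this one contains
  \<open>Y\<close>. It places expected matrices in \<open>S\<close>, where the directional bound on
  the gradient applies.\<close>

lemma affine_in_S:
  assumes "q \<in> convex hull Y" "v \<in> Yhat"
  shows "off v + lin v q \<in> S"
proof -
  interpret linear "lin v" by (rule linear_lin) fact
  have "convex {q. off v + lin v q \<in> S}"
  proof (rule convexI, safe)
    fix q r and s t :: real
    assume st: "0 \<le> s" "0 \<le> t" "s + t = 1" and qr: "off v + lin v q \<in> S" "off v + lin v r \<in> S"
    have "off v + lin v (s *\<^sub>R q + t *\<^sub>R r) = s *\<^sub>R (off v + lin v q) + t *\<^sub>R (off v + lin v r)"
      using st by (simp add: add scale scaleR_add_right scaleR_add_left[symmetric] flip: add.assoc)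
    then show "off v + lin v (s *\<^sub>R q + t *\<^sub>R r) \<in> S"
      using convexD[OF convex_S qr st] by simp
  qed
  moreover have "Y \<subseteq> {q. off v + lin v q \<in> S}"
    using conf_in_S[OF _ assms(2)] conf_eq[OF _ assms(2)] by auto
  ultimately show ?thesis using hull_minimal[of Y _ convex] assms(1) by blast
qed

text \<open>The definite description is legitimate: affinity makes the expectation depend on the
  mean alone, and convex weights of \<open>q\<close> over \<open>Y\<close> supply a distribution
  with that mean.\<close>

lemma expected_confusion_eq:
  assumes "q \<in> convex hull Y" "v \<in> Yhat"
  shows "expected_confusion conf Y q v = off v + lin v q"
proof -
  interpret linear "lin v" by (rule linear_lin) fact
  have E: "measure_pmf.expectation p (\<lambda>y. conf y v) = off v + lin v (measure_pmf.expectation p (\<lambda>y. y))"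
    if p: "set_pmf p \<subseteq> Y" for p
  proof -
    have "finite (set_pmf p)" using finite_Y p finite_subset by blast
    note int = integrable_measure_pmf_finite[OF this]
    have "measure_pmf.expectation p (\<lambda>y. conf y v) = measure_pmf.expectation p (\<lambda>y. off v + lin v y)"
      using p conf_eq[OF _ assms(2)] by (intro integral_cong_AE) (auto simp: AE_measure_pmf_iff)
    also have "\<dots> = off v + measure_pmf.expectation p (\<lambda>y. lin v y)"
      by (subst Bochner_Integration.integral_add) (simp_all add: int)
    also have "measure_pmf.expectation p (\<lambda>y. lin v y) = lin v (measure_pmf.expectation p (\<lambda>y. y))"
      by (intro integral_bounded_linear int linear_conv_bounded_linear[THEN iffD1] linear_lin assms)
    finally show ?thesis .
  qed
  obtain u where u: "\<forall>y\<in>Y. 0 \<le> u y" "sum u Y = 1" "(\<Sum>y\<in>Y. u y *\<^sub>R y) = q"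
    using assms(1) unfolding convex_hull_finite[OF finite_Y] by blast
  \<comment> \<open>The weights are extended by 0 to a probability mass function on the whole
    type.\<close>
  define f where "f y = (if y \<in> Y then u y else 0)" for y
  have f: "(\<And>y. 0 \<le> f y)" "(\<integral>\<^sup>+y. ennreal (f y) \<partial>count_space UNIV) = 1"
  proof -
    show "0 \<le> f y" for y using u(1) by (simp add: f_def)
    have "(\<integral>\<^sup>+y. ennreal (f y) \<partial>count_space UNIV) = (\<Sum>y\<in>Y. ennreal (f y))"
      by (rule nn_integral_count_space'[OF finite_Y]) (auto simp: f_def)
    also have "\<dots> = ennreal (\<Sum>y\<in>Y. u y)"
      using u(1) by (subst sum_ennreal) (auto simp: f_def)
    finally show "(\<integral>\<^sup>+y. ennreal (f y) \<partial>count_space UNIV) = 1" using u(2) by simp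
  qed
  define p where "p = embed_pmf f"
  have p: "set_pmf p \<subseteq> Y"
    unfolding p_def set_embed_pmf[OF f] by (auto simp: f_def)
  have "measure_pmf.expectation p (\<lambda>y. y) = (\<Sum>y\<in>Y. pmf p y *\<^sub>R y)"
    using p by (intro integral_measure_pmf finite_Y) auto
  also have "\<dots> = q"
    unfolding p_def pmf_embed_pmf[OF f] u(3)[symmetric] by (rule sum.cong) (auto simp: f_def)
  finally have q: "measure_pmf.expectation p (\<lambda>y. y) = q" .
  show ?thesis
    unfolding expected_confusion_def
  proof (rule the_equality)
    show "\<exists>p. set_pmf p \<subseteq> Y \<and> measure_pmf.expectation p (\<lambda>y. y) = q
        \<and> off v + lin v q = measure_pmf.expectation p (\<lambda>y. conf y v)"
      using p q E[OF p] by auto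
  qed (use E in auto)
qed

end

subsection \<open>One round against the data distribution\<close>

locale label_model =
  fixes X :: "'x measure" and Y :: "(real^'m) set" and P :: "('x \<times> (real^'m)) measure"
    and \<eta> :: "'x \<Rightarrow> real^'m"
  assumes data: "data_model X Y P \<eta>" and finite_labels: "finite Y"
begin

lemma prob_space_P: "prob_space P"
  and sets_P: "sets P = sets (X \<Otimes>\<^sub>M count_space Y)"
  and measurable_eta [measurable]: "\<eta> \<in> borel_measurable X"
  and eta_box: "x \<in> space X \<Longrightarrow> \<eta> x \<in> unit_box"
  and eta_cond: "AE z in P. \<eta> (fst z) $ j
            = real_cond_exp P (vimage_algebra (space P) fst X) (\<lambda>z. snd z $ j) z"
  using data by (auto simp: data_model_def)

lemma space_P: "space P = space X \<times> Y"
  using sets_eq_imp_space_eq[OF sets_P] by (simp add: space_pair_measure)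

lemma measurable_fst_P [measurable]: "fst \<in> P \<rightarrow>\<^sub>M X"
  and measurable_snd_P: "snd \<in> P \<rightarrow>\<^sub>M count_space Y"
  using measurable_fst[of X "count_space Y"] measurable_snd[of X "count_space Y"]
  by (simp_all add: measurable_cong_sets[OF sets_P refl])

lemma simple_snd: "simple_function P snd"
  by (rule measurable_imp_simple_function[OF measurable_snd_P finite_labels])

lemma subalgebra_fst: "finite_measure_subalgebra P (vimage_algebra (space P) fst X)"
proof -
  interpret prob_space P by (rule prob_space_P)
  show ?thesis
    using sets_image_in_sets[OF refl measurable_fst_P]
    by unfold_locales (simp add: subalgebra_def)
qed

text \<open>The coordinate sum of the label is constant, hence equal to its own conditional
  expectation. The conclusion is almost sure because \<eta> is tied to the conditional expectation
  only almost surely.\<close>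

lemma AE_eta_sum:
  assumes "\<And>y. y \<in> Y \<Longrightarrow> (\<Sum>j\<in>UNIV. y $ j) = s"
  shows "AE z in P. (\<Sum>j\<in>UNIV. \<eta> (fst z) $ j) = s"
proof -
  let ?F = "vimage_algebra (space P) fst X"
  interpret finite_measure_subalgebra P ?F by (rule subalgebra_fst)
  have int: "integrable P (\<lambda>z. snd z $ j)" for j
    by (rule simple_function_integrable[OF simple_function_compose1[OF simple_snd]])
  have sum_eq: "(\<Sum>j\<in>UNIV. snd z $ j) = s" if "z \<in> space P" for z
    using that assms by (auto simp: space_P)
  then have "(\<lambda>z. \<Sum>j\<in>UNIV. snd z $ j) \<in> borel_measurable ?F"
    by (subst measurable_cong[where g = "\<lambda>_. s"]) auto
  then have "AE z in P. real_cond_exp P ?F (\<lambda>z. \<Sum>j\<in>UNIV. snd z $ j) z = (\<Sum>j\<in>UNIV. snd z $ j)"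
    using int by (intro real_cond_exp_F_meas Bochner_Integration.integrable_sum)
  moreover have "AE z in P. real_cond_exp P ?F (\<lambda>z. \<Sum>j\<in>UNIV. snd z $ j) z
      = (\<Sum>j\<in>UNIV. real_cond_exp P ?F (\<lambda>z. snd z $ j) z)"
    by (rule real_cond_exp_sum[OF int])
  moreover have "AE z in P. \<forall>j\<in>UNIV. \<eta> (fst z) $ j = real_cond_exp P ?F (\<lambda>z. snd z $ j) z"
    using eta_cond by (intro AE_finite_allI) auto
  ultimately show ?thesis
    using AE_space by eventually_elim (simp add: sum_eq)
qed

end

locale omma_setting = affine_confusion conf Y Yhat off lin a b + label_model X Y P \<eta>
  for conf :: "real^'m \<Rightarrow> real^'m \<Rightarrow> 'c::euclidean_space" and Y Yhat off lin a b
    and X :: "'x measure" and P :: "('x \<times> (real^'m)) measure" and \<eta> :: "'x \<Rightarrow> real^'m" +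
  fixes n :: nat and Q :: "(real^'m) set"
    and \<eta>h :: "nat \<Rightarrow> (nat \<Rightarrow> 'x \<times> (real^'m)) \<Rightarrow> 'x \<Rightarrow> real^'m"
  assumes eta_hull: "AE z in P. \<eta> (fst z) \<in> convex hull Y"
    and est: "estimates X P n Q \<eta>h"
    and Q_hull: "Q \<subseteq> convex hull Y"
begin

interpretation P: prob_space P by (rule prob_space_P)

lemma hull_bound:
  obtains B where "B \<ge> 0" "\<And>q. q \<in> convex hull Y \<Longrightarrow> norm q \<le> B"
proof -
  have "bounded (convex hull Y)"
    using finite_Y by (intro bounded_convex_hull finite_imp_bounded)
  then obtain B where "\<forall>q\<in>convex hull Y. norm q \<le> B" unfolding bounded_iff by auto
  then show ?thesis by (intro that[of "max B 0"]) (auto simp: le_max_iff_disj)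
qed

lemma integrable_inner_eta:
  assumes "simple_function X H"
  shows "integrable P (\<lambda>z. H (fst z) \<bullet> \<eta> (fst z))"
proof -
  obtain B where B: "B \<ge> 0" "\<And>q. q \<in> convex hull Y \<Longrightarrow> norm q \<le> B"
    using hull_bound by blast
  obtain K where K: "K \<ge> 0" "\<And>x. x \<in> space X \<Longrightarrow> norm (H x) \<le> K"
    using simple_function_bounded[OF assms] by blast
  note [measurable] = borel_measurable_simple_function[OF assms]
  show ?thesis
  proof (rule P.integrable_const_bound[where B = "K * B"])
    show "AE z in P. norm (H (fst z) \<bullet> \<eta> (fst z)) \<le> K * B"
      using eta_hull AE_space
    proof eventually_elim
      case (elim z)
      have "norm (H (fst z) \<bullet> \<eta> (fst z)) \<le> norm (H (fst z)) * norm (\<eta> (fst z))"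
        using Cauchy_Schwarz_ineq2 by simp
      also have "\<dots> \<le> K * B"
        using elim B K by (intro mult_mono) (auto simp: space_P)
      finally show ?case .
    qed
  qed measurable
qed

text \<open>The defining property of conditional expectation, coordinate by coordinate, with the
  instance-measurable multiplier \<open>H x $ j\<close>.\<close>

lemma integral_inner_label:
  assumes H: "simple_function X H"
  shows "(\<integral>z. H (fst z) \<bullet> snd z \<partial>P) = (\<integral>z. H (fst z) \<bullet> \<eta> (fst z) \<partial>P)"
proof -
  let ?F = "vimage_algebra (space P) fst X"
  have fst_F: "fst \<in> ?F \<rightarrow>\<^sub>M X"
    by (rule measurable_vimage_algebra1) (auto simp: space_P)
  interpret finite_measure_subalgebra P ?F by (rule subalgebra_fst)
  have Hj: "simple_function X (\<lambda>x. H x $ j)" for j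
    by (rule simple_function_compose1) fact
  have *: "simple_function P (\<lambda>z. H (fst z) $ j)" for j
    by (rule simple_function_measurable_compose[OF Hj measurable_fst_P])
  have s: "simple_function P (\<lambda>z. H (fst z) $ j * snd z $ j)" for j
    by (rule simple_function_compose2[OF * simple_function_compose1[OF simple_snd]])
  have meas: "(\<lambda>z. H (fst z) $ j) \<in> borel_measurable ?F" for j
    using measurable_compose[OF fst_F borel_measurable_simple_function[OF Hj]] .
  have snd_meas: "(\<lambda>z. snd z $ j) \<in> borel_measurable P" for j
    by (rule borel_measurable_simple_function[OF simple_function_compose1[OF simple_snd]])
  note intg = real_cond_exp_intg[OF P.simple_function_integrable[OF s] meas snd_meas]
  have ae: "AE z in P. H (fst z) $ j * real_cond_exp P ?F (\<lambda>z. snd z $ j) z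
      = H (fst z) $ j * \<eta> (fst z) $ j" for j
    using eta_cond[of j] by eventually_elim simp
  have measP: "(\<lambda>z. H (fst z) $ j * \<eta> (fst z) $ j) \<in> borel_measurable P" for j
  proof -
    have "(\<lambda>q::real^'m. q $ j) \<in> borel_measurable borel"
      by (intro borel_measurable_continuous_onI continuous_intros)
    from measurable_compose[OF measurable_compose[OF measurable_fst_P measurable_eta] this]
    show ?thesis by (intro borel_measurable_times borel_measurable_simple_function[OF *])
  qed
  have int: "integrable P (\<lambda>z. H (fst z) $ j * \<eta> (fst z) $ j)" for j
    using integrable_cong_AE_imp[OF intg(1) measP ae] .
  have eq: "(\<integral>z. H (fst z) $ j * \<eta> (fst z) $ j \<partial>P) = (\<integral>z. H (fst z) $ j * snd z $ j \<partial>P)" for j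
    using integral_cong_AE[OF _ measP ae] intg by (simp add: borel_measurable_integrable)
  have "(\<integral>z. H (fst z) \<bullet> snd z \<partial>P) = (\<Sum>j\<in>UNIV. \<integral>z. H (fst z) $ j * snd z $ j \<partial>P)"
    using P.simple_function_integrable[OF s] by (simp add: inner_vec_def)
  also have "\<dots> = (\<Sum>j\<in>UNIV. \<integral>z. H (fst z) $ j * \<eta> (fst z) $ j \<partial>P)"
    by (simp add: eq)
  also have "\<dots> = (\<integral>z. H (fst z) \<bullet> \<eta> (fst z) \<partial>P)"
    using int by (simp add: inner_vec_def)
  finally show ?thesis .
qed

lemma simple_conf:
  assumes "v \<in> X \<rightarrow>\<^sub>M count_space Yhat"
  shows "simple_function P (\<lambda>z. conf (snd z) (v (fst z)))"
  using simple_function_compose2[OF simple_snd simple_function_measurable_compose[OF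
      measurable_imp_simple_function[OF assms finite_Yhat] measurable_fst_P]] .

lemma expectation_conf:
  assumes v: "v \<in> X \<rightarrow>\<^sub>M count_space Yhat"
  shows "integrable P (\<lambda>z. g \<bullet> (off (v (fst z)) + lin (v (fst z)) (\<eta> (fst z))))"
    and "(\<integral>z. g \<bullet> conf (snd z) (v (fst z)) \<partial>P)
      = (\<integral>z. g \<bullet> (off (v (fst z)) + lin (v (fst z)) (\<eta> (fst z))) \<partial>P)"
proof -
  \<comment> \<open>The adjoint moves the prediction into a function of the instance alone; the
    label is left as the other factor of an inner product and can be averaged to \<eta>.\<close>
  define H where "H x = adjoint (lin (v x)) g" for x
  have simple_v: "simple_function X v"
    by (rule measurable_imp_simple_function[OF v finite_Yhat])
  then have H: "simple_function X H" unfolding H_def by (rule simple_function_compose1)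
  have v_in: "v (fst z) \<in> Yhat" if "z \<in> space P" for z
    using measurable_space[OF v] that by (auto simp: space_P)
  have lin_H: "g \<bullet> (off (v (fst z)) + lin (v (fst z)) q) = g \<bullet> off (v (fst z)) + H (fst z) \<bullet> q"
    if "z \<in> space P" for z q
    using adjoint_works[OF linear_lin[OF v_in[OF that]], of q g]
    by (simp add: H_def inner_add_right inner_commute)
  have off: "integrable P (\<lambda>z. g \<bullet> off (v (fst z)))"
    using P.simple_function_integrable[OF simple_function_compose1[OF
          simple_function_measurable_compose[OF simple_v measurable_fst_P]]] .
  have label: "integrable P (\<lambda>z. H (fst z) \<bullet> snd z)"
    using P.simple_function_integrable[OF simple_function_compose2[OF
          simple_function_measurable_compose[OF H measurable_fst_P] simple_snd]] .
  show "integrable P (\<lambda>z. g \<bullet> (off (v (fst z)) + lin (v (fst z)) (\<eta> (fst z))))"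
    using Bochner_Integration.integrable_add[OF off integrable_inner_eta[OF H]]
    by (rule Bochner_Integration.integrable_cong[OF refl, THEN iffD1, rotated]) (simp add: lin_H)
  have "(\<integral>z. g \<bullet> conf (snd z) (v (fst z)) \<partial>P) = (\<integral>z. g \<bullet> off (v (fst z)) + H (fst z) \<bullet> snd z \<partial>P)"
  proof (rule Bochner_Integration.integral_cong[OF refl])
    fix z assume z: "z \<in> space P"
    then have "snd z \<in> Y" by (auto simp: space_P)
    then show "g \<bullet> conf (snd z) (v (fst z)) = g \<bullet> off (v (fst z)) + H (fst z) \<bullet> snd z"
      using lin_H[OF z, of "snd z"] conf_eq[OF _ v_in[OF z]] by simp
  qed
  also have "\<dots> = (\<integral>z. g \<bullet> off (v (fst z)) + H (fst z) \<bullet> \<eta> (fst z) \<partial>P)"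
    using off label integrable_inner_eta[OF H] integral_inner_label[OF H] by simp
  also have "\<dots> = (\<integral>z. g \<bullet> (off (v (fst z)) + lin (v (fst z)) (\<eta> (fst z))) \<partial>P)"
    by (rule Bochner_Integration.integral_cong[OF refl]) (simp add: lin_H)
  finally show "(\<integral>z. g \<bullet> conf (snd z) (v (fst z)) \<partial>P)
      = (\<integral>z. g \<bullet> (off (v (fst z)) + lin (v (fst z)) (\<eta> (fst z))) \<partial>P)" .
qed

definition comparator :: "('x \<Rightarrow> real^'m) \<Rightarrow> 'c" where
  "comparator h = (\<integral>z. conf (snd z) (h (fst z)) \<partial>P)"

lemma comparator_in_S:
  assumes "h \<in> X \<rightarrow>\<^sub>M count_space Yhat"
  shows "comparator h \<in> S"
  unfolding comparator_def
proof (rule P.integral_in_closed_convex[OF convex_S compact_imp_closed[OF compact_S]])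
  show "integrable P (\<lambda>z. conf (snd z) (h (fst z)))"
    by (rule P.simple_function_integrable[OF simple_conf[OF assms]])
  show "conf (snd z) (h (fst z)) \<in> S" if "z \<in> space P" for z
    using that measurable_space[OF assms] by (intro conf_in_S) (auto simp: space_P)
qed

text \<open>Swapping \<open>\<eta>\<close> for the estimate \<open>q\<close> costs \<open>b * L * norm (\<eta> - q)\<close>, once for the prediction \<open>v\<close>
  and once for the classifier \<open>h\<close>; under \<open>q\<close> itself \<open>v\<close> is at least as good as \<open>h\<close>.\<close>

lemma one_step:
  assumes v: "v \<in> X \<rightarrow>\<^sub>M count_space Yhat" and h: "h \<in> X \<rightarrow>\<^sub>M count_space Yhat"
    and q [measurable]: "q \<in> borel_measurable X"
    and q_hull: "\<And>x. x \<in> space X \<Longrightarrow> q x \<in> convex hull Y"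
    and max: "\<And>x w. x \<in> space X \<Longrightarrow> w \<in> Yhat \<Longrightarrow>
      g \<bullet> (off w + lin w (q x)) \<le> g \<bullet> (off (v x) + lin (v x) (q x))"
    and g: "\<And>A B. A \<in> S \<Longrightarrow> B \<in> S \<Longrightarrow> g \<bullet> (A - B) \<le> L * norm (A - B)"
    and L: "L \<ge> 0"
  shows "0 \<le> (\<integral>z. g \<bullet> (conf (snd z) (v (fst z)) - comparator h)
      + 2 * b * L * norm (\<eta> (fst z) - q (fst z)) \<partial>P)"
proof -
  let ?A = "\<lambda>w r z. off (w (fst z)) + lin (w (fst z)) (r (fst z))"
  let ?e = "\<lambda>z. norm (\<eta> (fst z) - q (fst z))"
  obtain B where B: "B \<ge> 0" "\<And>q. q \<in> convex hull Y \<Longrightarrow> norm q \<le> B"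
    using hull_bound by blast
  have e: "integrable P ?e"
  proof (rule P.integrable_const_bound[where B = "B + B"])
    show "AE z in P. norm (?e z) \<le> B + B"
      using eta_hull AE_space
    proof eventually_elim
      case (elim z)
      then have "norm (\<eta> (fst z)) \<le> B" "norm (q (fst z)) \<le> B"
        by (auto intro!: B q_hull simp: space_P)
      then show ?case using norm_triangle_ineq4[of "\<eta> (fst z)" "q (fst z)"] by simp
    qed
  qed measurable
  \<comment> \<open>Both matrices lie in \<open>S\<close>, so \<open>g\<close> is tested on a
    difference that it controls; the offsets cancel and \<open>lin w (r - r')\<close>
    remains.\<close>
  have swap: "g \<bullet> (off w + lin w r) - b * L * norm (r - r') \<le> g \<bullet> (off w + lin w r')"
    if "w \<in> Yhat" "r \<in> convex hull Y" "r' \<in> convex hull Y" for w r r'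
  proof -
    have "g \<bullet> ((off w + lin w r) - (off w + lin w r')) \<le> L * norm (lin w (r - r'))"
      using g[OF affine_in_S[OF that(2,1)] affine_in_S[OF that(3,1)]]
      by (simp add: linear_diff[OF linear_lin[OF that(1)]])
    also have "\<dots> \<le> L * (b * norm (r - r'))"
      using norm_lin_le[OF that(1)] L by (rule mult_left_mono)
    finally show ?thesis by (simp only: inner_diff_right mult_ac)
  qed
  have ge: "AE z in P. g \<bullet> ?A h \<eta> z - 2 * b * L * ?e z \<le> g \<bullet> ?A v \<eta> z"
    using eta_hull AE_space
  proof eventually_elim
    case (elim z)
    then have x: "fst z \<in> space X" by (auto simp: space_P)
    note in_Yhat = measurable_space[OF v x] measurable_space[OF h x]
    show ?case
      using swap[of "h (fst z)" "\<eta> (fst z)" "q (fst z)"] max[OF x, of "h (fst z)"]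
        swap[of "v (fst z)" "q (fst z)" "\<eta> (fst z)"] in_Yhat q_hull[OF x] elim(1)
      by (simp add: norm_minus_commute[of "q (fst z)"])
  qed
  note iv = expectation_conf[OF v, of g] and ih = expectation_conf[OF h, of g]
  have conf: "integrable P (\<lambda>z. conf (snd z) (w (fst z)))" if "w \<in> X \<rightarrow>\<^sub>M count_space Yhat" for w
    by (rule P.simple_function_integrable[OF simple_conf[OF that]])
  have "g \<bullet> comparator h = (\<integral>z. g \<bullet> ?A h \<eta> z \<partial>P)"
    using ih(2) conf[OF h] by (simp add: comparator_def)
  then have "g \<bullet> comparator h - 2 * b * L * (\<integral>z. ?e z \<partial>P)
      = (\<integral>z. g \<bullet> ?A h \<eta> z - 2 * b * L * ?e z \<partial>P)"
    using ih(1) e by simp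
  also have "\<dots> \<le> (\<integral>z. g \<bullet> ?A v \<eta> z \<partial>P)"
    using ih(1) iv(1) e ge by (intro integral_mono_AE) auto
  also have "\<dots> = (\<integral>z. g \<bullet> conf (snd z) (v (fst z)) \<partial>P)" using iv(2) by simp
  finally have "g \<bullet> comparator h - 2 * b * L * (\<integral>z. ?e z \<partial>P)
      \<le> (\<integral>z. g \<bullet> conf (snd z) (v (fst z)) \<partial>P)" .
  then show ?thesis
    using conf[OF v] e P.prob_space by (simp add: inner_diff_right)
qed

end

subsection \<open>The OMMA recursion\<close>

text \<open>Keeps index sets in the form \<open>{1..n}\<close> instead of \<open>{Suc 0..n}\<close>.\<close>
declare One_nat_def [simp del]

lemma at_trial_fun_upd: "s < t \<Longrightarrow> at_trial f s (w(t := z)) = at_trial f s w"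
  by (simp add: at_trial_def restrict_def fun_eq_iff cong: if_cong)

text \<open>The state before round \<open>t\<close> stays frozen while coordinate \<open>t\<close>
  is integrated out.\<close>

lemma omma_confusion_fun_upd:
  "s < t \<Longrightarrow> omma_confusion conf C0 yh (w(t := z)) s = omma_confusion conf C0 yh w s"
  by (induction s) (simp_all add: at_trial_fun_upd)

text \<open>Scaling by the number of rounds turns the recursion into a plain sum. The factor
  \<open>real 0\<close> in the first update erases \<open>C0\<close>, so the start is
  arbitrary.\<close>

lemma omma_confusion_eq_mean:
  "n \<ge> 1 \<Longrightarrow> omma_confusion conf C0 yh \<omega> n
    = mean_confusion conf n (\<lambda>t. snd (\<omega> t)) (\<lambda>t. at_trial yh t \<omega>)"
proof -
  have "real n *\<^sub>R omma_confusion conf C0 yh \<omega> n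
      = (\<Sum>t=1..n. conf (snd (\<omega> t)) (at_trial yh t \<omega>))" for n
    by (induction n) (simp_all add: scaleR_add_right)
  from this[of n, symmetric] show "n \<ge> 1 \<Longrightarrow> ?thesis"
    unfolding mean_confusion_def by simp
qed

locale omma_run = omma_setting conf Y Yhat off lin a b X P \<eta> n Q \<eta>h
  for conf :: "real^'m \<Rightarrow> real^'m \<Rightarrow> 'c::euclidean_space" and Y Yhat off lin a b
    and X :: "'x measure" and P :: "('x \<times> (real^'m)) measure" and \<eta> n Q \<eta>h +
  fixes \<phi> :: "'c \<Rightarrow> real" and C0 :: 'c
    and yh :: "nat \<Rightarrow> (nat \<Rightarrow> 'x \<times> (real^'m)) \<Rightarrow> 'x \<Rightarrow> real^'m"
    and h :: "'x \<Rightarrow> real^'m" and \<kappa> L :: real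
  assumes omma: "omma conf Y Yhat X P n \<phi> C0 \<eta>h yh"
    and smooth: "smooth_concave_on (confusion_hull conf Y Yhat) \<phi> (grad \<phi>) \<kappa> L"
    and h: "h \<in> X \<rightarrow>\<^sub>M count_space Yhat"
    and kappa_nonneg: "\<kappa> \<ge> 0" and L_nonneg: "L \<ge> 0"
begin

interpretation P: prob_space P by (rule prob_space_P)

interpretation product_sigma_finite "\<lambda>_::nat. P"
  by (rule product_sigma_finite.intro) (rule P.sigma_finite_measure_axioms)

interpretation Pn: prob_space "iid P {1..n}"
  by (rule prob_space_PiM) (rule prob_space_P)

lemma coordinate: "t \<in> I \<Longrightarrow> (\<lambda>\<omega>. \<omega> t) \<in> iid P I \<rightarrow>\<^sub>M P"
  by (rule measurable_component_singleton)

abbreviation Cm :: "(nat \<Rightarrow> 'x \<times> (real^'m)) \<Rightarrow> nat \<Rightarrow> 'c" where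
  "Cm \<equiv> omma_confusion conf C0 yh"

abbreviation conf_at :: "nat \<Rightarrow> (nat \<Rightarrow> 'x \<times> (real^'m)) \<Rightarrow> 'c" where
  "conf_at t \<omega> \<equiv> conf (snd (\<omega> t)) (at_trial yh t \<omega>)"

abbreviation err :: "nat \<Rightarrow> (nat \<Rightarrow> 'x \<times> (real^'m)) \<Rightarrow> real" where
  "err t \<omega> \<equiv> norm (\<eta> (fst (\<omega> t)) - at_trial \<eta>h t \<omega>)"

lemma C0_in_S: "C0 \<in> S" and yh: "nonanticipating X P n (count_space Yhat) yh"
  using omma by (auto simp: omma_def)

lemma tangent_upper: "A \<in> S \<Longrightarrow> B \<in> S \<Longrightarrow> \<phi> B \<le> \<phi> A + grad \<phi> A \<bullet> (B - A)"
  and tangent_lower: "A \<in> S \<Longrightarrow> B \<in> S \<Longrightarrow>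
    \<phi> A + grad \<phi> A \<bullet> (B - A) - \<kappa> / 2 * (norm (B - A))\<^sup>2 \<le> \<phi> B"
  and grad_direction: "C \<in> S \<Longrightarrow> A \<in> S \<Longrightarrow> B \<in> S \<Longrightarrow> grad \<phi> C \<bullet> (A - B) \<le> L * norm (A - B)"
  using smooth unfolding smooth_concave_on_def by blast+

lemma measurable_at_trial:
  assumes "nonanticipating X P n A f" "t \<in> {1..n}"
  shows "at_trial f t \<in> iid P {1..n} \<rightarrow>\<^sub>M A"
proof -
  have "(\<lambda>\<omega>. (restrict \<omega> {1..<t}, fst (\<omega> t))) \<in> iid P {1..n} \<rightarrow>\<^sub>M iid P {1..<t} \<Otimes>\<^sub>M X"
    using assms(2)
    by (intro measurable_Pair measurable_restrict_subset
        measurable_compose[OF coordinate measurable_fst_P]) auto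
  from measurable_compose[OF this, of "\<lambda>(w, x). f t w x" A] show ?thesis
    using assms unfolding nonanticipating_def at_trial_def[abs_def] by simp
qed

lemma measurable_section:
  assumes "nonanticipating X P n A f" "t \<in> {1..n}" "w \<in> space (iid P {1..<t})"
  shows "f t w \<in> X \<rightarrow>\<^sub>M A"
  using measurable_compose[OF measurable_Pair1'[OF assms(3)], of "\<lambda>(w, x). f t w x" X A] assms(1,2)
  unfolding nonanticipating_def by simp

lemma at_trial_in:
  assumes "nonanticipating X P n A f" "t \<in> {1..n}" "{1..t} \<subseteq> I" "w \<in> space (iid P I)"
  shows "at_trial f t w \<in> space A"
proof -
  have w: "w s \<in> space P" if "s \<in> {1..t}" for s
    using measurable_space[OF coordinate assms(4)] that assms(3) by auto
  then have "restrict w {1..<t} \<in> space (iid P {1..<t})"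
    by (auto simp: space_PiM PiE_iff)
  moreover have "fst (w t) \<in> space X"
    using w[of t] assms(2) by (auto simp: space_P)
  ultimately show ?thesis
    unfolding at_trial_def using measurable_space[OF measurable_section[OF assms(1,2)]] by blast
qed

lemma label_in: "t \<in> I \<Longrightarrow> w \<in> space (iid P I) \<Longrightarrow> snd (w t) \<in> Y"
  using measurable_space[OF coordinate] by (fastforce simp: space_P)

lemma instance_in: "t \<in> I \<Longrightarrow> w \<in> space (iid P I) \<Longrightarrow> fst (w t) \<in> space X"
  using measurable_space[OF coordinate] by (fastforce simp: space_P)

text \<open>The index set \<open>I\<close> is kept general because the state is considered both on
  the full product and on the product with the next coordinate removed.\<close>

lemma Cm_in_S:
  assumes "t \<le> n" "{1..t} \<subseteq> I" "w \<in> space (iid P I)"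
  shows "Cm w t \<in> S"
  using assms(1,2)
proof (induction t)
  case (Suc t)
  have "conf_at (Suc t) w \<in> S"
    using at_trial_in[OF yh _ Suc.prems(2) assms(3)] Suc.prems
    by (intro conf_in_S label_in[OF _ assms(3)]) auto
  moreover have "real t / real (Suc t) + 1 / real (Suc t) = 1" by (simp add: field_simps)
  moreover have "{1..t} \<subseteq> I" using Suc.prems by auto
  ultimately show ?case
    using Suc unfolding omma_confusion.simps
    by (intro convexD[OF convex_S]) auto
qed (simp add: C0_in_S)

lemma simple_label: "t \<in> {1..n} \<Longrightarrow> simple_function (iid P {1..n}) (\<lambda>\<omega>. snd (\<omega> t))"
  by (rule simple_function_measurable_compose[OF simple_snd coordinate])

lemma simple_conf_at: "t \<in> {1..n} \<Longrightarrow> simple_function (iid P {1..n}) (conf_at t)"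
  by (intro simple_function_compose2[of _ _ _ conf] simple_label
      measurable_imp_simple_function[OF measurable_at_trial[OF yh] finite_Yhat])

text \<open>Finite range is what later allows composition with \<phi> and \<open>grad \<phi>\<close>
  without any measurability of these.\<close>

lemma simple_Cm: "t \<le> n \<Longrightarrow> simple_function (iid P {1..n}) (\<lambda>\<omega>. Cm \<omega> t)"
proof (induction t)
  case (Suc t)
  have "simple_function (iid P {1..n}) (\<lambda>\<omega>. Cm \<omega> t)"
      and "simple_function (iid P {1..n}) (conf_at (Suc t))"
    using Suc by (auto intro: simple_conf_at)
  from simple_function_compose2[OF this,
      of "\<lambda>A B. (real t / real (Suc t)) *\<^sub>R A + (1 / real (Suc t)) *\<^sub>R B"]
  show ?case by simp
qed simp

lemma estimates_nonanticipating: "nonanticipating X P n (restrict_space borel Q) \<eta>h"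
  using est by (simp add: estimates_def)

lemma integrable_err:
  assumes t: "t \<in> {1..n}"
  shows "integrable (iid P {1..n}) (err t)"
proof -
  obtain B where B: "B \<ge> 0" "\<And>q. q \<in> convex hull Y \<Longrightarrow> norm q \<le> B"
    using hull_bound by blast
  have "AE \<omega> in iid P {1..n}. \<eta> (fst (\<omega> t)) \<in> convex hull Y"
    using eta_hull by (rule AE_PiM_component[OF prob_space_P t])
  then have "AE \<omega> in iid P {1..n}. norm (err t \<omega>) \<le> B + B"
    using AE_space
  proof eventually_elim
    case (elim \<omega>)
    have "at_trial \<eta>h t \<omega> \<in> Q"
      using at_trial_in[OF estimates_nonanticipating t _ elim(2)] t by (auto simp: space_restrict_space)
    then show ?case
      using B(2)[OF elim(1)] B(2)[of "at_trial \<eta>h t \<omega>"] Q_hull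
        norm_triangle_ineq4[of "\<eta> (fst (\<omega> t))" "at_trial \<eta>h t \<omega>"] by auto
  qed
  moreover have "(\<lambda>\<omega>. at_trial \<eta>h t \<omega>) \<in> borel_measurable (iid P {1..n})"
    using measurable_at_trial[OF estimates_nonanticipating t] by (simp add: measurable_restrict_space2_iff)
  then have "err t \<in> borel_measurable (iid P {1..n})"
    by (intro measurable_compose[OF borel_measurable_diff borel_measurable_norm]
        measurable_compose[OF measurable_compose[OF coordinate[OF t] measurable_fst_P] measurable_eta])
  ultimately show ?thesis by (intro Pn.integrable_const_bound)
qed

lemma integrable_gain:
  assumes "Suc t \<le> n"
  shows "integrable (iid P {1..n}) (\<lambda>\<omega>. grad \<phi> (Cm \<omega> t) \<bullet> (conf_at (Suc t) \<omega> - comparator h))"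
  using assms
  by (intro Pn.simple_function_integrable
      simple_function_compose2[of _ _ _ "\<lambda>A B. grad \<phi> A \<bullet> (B - comparator h)"]
      simple_Cm simple_conf_at) auto

text \<open>Fubini with coordinate \<open>Suc t\<close> innermost: for frozen other coordinates the
  gradient, the estimator and the prediction rule are fixed, and \<open>one_step\<close> applies to
  the fresh example.\<close>

lemma expected_gain:
  assumes t: "Suc t \<le> n"
  shows "0 \<le> (\<integral>\<omega>. grad \<phi> (Cm \<omega> t) \<bullet> (conf_at (Suc t) \<omega> - comparator h)
      + 2 * b * L * err (Suc t) \<omega> \<partial>iid P {1..n})" (is "0 \<le> integral\<^sup>L _ ?D")
proof -
  define I where "I = {1..n} - {Suc t}"
  have I: "insert (Suc t) I = {1..n}" "finite I" "Suc t \<notin> I" "{1..t} \<subseteq> I" "{1..<Suc t} \<subseteq> I"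
    and tn: "Suc t \<in> {1..n}"
    using t by (auto simp: I_def)
  have "integrable (iid P {1..n}) ?D"
    using integrable_gain[OF t] integrable_err[OF tn] by simp
  then have "integral\<^sup>L (iid P {1..n}) ?D = (\<integral>w. (\<integral>z. ?D (w(Suc t := z)) \<partial>P) \<partial>iid P I)"
    using product_integral_insert[OF I(2,3), of ?D] unfolding I(1) by simp
  also have "\<dots> \<ge> 0"
  proof (rule Bochner_Integration.integral_nonneg)
    fix w assume w: "w \<in> space (iid P I)"
    define w' where "w' = restrict w {1..<Suc t}"
    have w': "w' \<in> space (iid P {1..<Suc t})"
      using w I(5) by (auto simp: w'_def space_PiM PiE_iff)
    have upd: "restrict (w(Suc t := z)) {1..<Suc t} = w'" for z
      by (auto simp: w'_def restrict_def fun_eq_iff)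
    have now: "at_trial f (Suc t) (w(Suc t := z)) = f (Suc t) w' (fst z)"
      for f :: "nat \<Rightarrow> (nat \<Rightarrow> 'x \<times> (real^'m)) \<Rightarrow> 'x \<Rightarrow> real^'m" and z
      unfolding at_trial_def upd by simp
    let ?g = "grad \<phi> (Cm w t)"
    have "?D (w(Suc t := z)) = ?g \<bullet> (conf (snd z) (yh (Suc t) w' (fst z)) - comparator h)
        + 2 * b * L * norm (\<eta> (fst z) - \<eta>h (Suc t) w' (fst z))" for z
      unfolding now omma_confusion_fun_upd[OF lessI] by simp
    moreover have "0 \<le> (\<integral>z. ?g \<bullet> (conf (snd z) (yh (Suc t) w' (fst z)) - comparator h)
        + 2 * b * L * norm (\<eta> (fst z) - \<eta>h (Suc t) w' (fst z)) \<partial>P)"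
    proof (rule one_step[OF measurable_section[OF yh tn w'] h])
      note q = measurable_section[OF estimates_nonanticipating tn w']
      show "\<eta>h (Suc t) w' \<in> borel_measurable X"
        using q by (simp add: measurable_restrict_space2_iff)
      show q_hull: "\<eta>h (Suc t) w' x \<in> convex hull Y" if "x \<in> space X" for x
        using measurable_space[OF q that] Q_hull by (auto simp: space_restrict_space)
      have "Cm w t \<in> S" using t by (intro Cm_in_S[OF _ I(4) w]) simp
      then show "?g \<bullet> (A - B) \<le> L * norm (A - B)" if "A \<in> S" "B \<in> S" for A B
        using that by (rule grad_direction)
      fix x v assume x: "x \<in> space X" and v: "v \<in> Yhat"
      \<comment> \<open>The arg-max property is stated for complete paths, so \<open>w\<close> is
        completed by \<open>(x, y)\<close>; any label will do, as the prediction sees only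
        \<open>x\<close>.\<close>
      obtain y where y: "y \<in> Y" using P.not_empty by (auto simp: space_P)
      define \<omega> where "\<omega> = w(Suc t := (x, y))"
      have "\<omega> \<in> space (iid P {1..n})"
        using w x y unfolding \<omega>_def space_PiM I(1)[symmetric] by (intro PiE_fun_upd) (auto simp: space_P)
      then have "is_arg_max (\<lambda>v. grad \<phi> (Cm \<omega> (Suc t - 1)) \<bullet> expected_confusion conf Y (at_trial \<eta>h (Suc t) \<omega>) v)
          (\<lambda>v. v \<in> Yhat) (at_trial yh (Suc t) \<omega>)"
        using omma tn unfolding omma_def by blast
      then have "is_arg_max (\<lambda>v. ?g \<bullet> expected_confusion conf Y (\<eta>h (Suc t) w' x) v)
          (\<lambda>v. v \<in> Yhat) (yh (Suc t) w' x)"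
        unfolding \<omega>_def now diff_Suc_1 omma_confusion_fun_upd[OF lessI] by simp
      then have "yh (Suc t) w' x \<in> Yhat" "?g \<bullet> expected_confusion conf Y (\<eta>h (Suc t) w' x) v
          \<le> ?g \<bullet> expected_confusion conf Y (\<eta>h (Suc t) w' x) (yh (Suc t) w' x)"
        using v by (auto simp: is_arg_max_def not_less)
      then show "?g \<bullet> (off v + lin v (\<eta>h (Suc t) w' x))
          \<le> ?g \<bullet> (off (yh (Suc t) w' x) + lin (yh (Suc t) w' x) (\<eta>h (Suc t) w' x))"
        using expected_confusion_eq[OF q_hull[OF x]] v by simp
    qed (rule L_nonneg)
    ultimately show "0 \<le> (\<integral>z. ?D (w(Suc t := z)) \<partial>P)" by simp
  qed
  finally show ?thesis .
qed

section \<open>Progress of a single round and telescoping\<close>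

abbreviation value_at :: "nat \<Rightarrow> real" where
  "value_at t \<equiv> (\<integral>\<omega>. \<phi> (Cm \<omega> t) \<partial>iid P {1..n})"

text \<open>\<open>C\<close> is the old state, \<open>A\<close> the new single-pair matrix and
  \<open>B\<close> the comparator. The quadratic minorant at \<open>C\<close> is scaled by
  \<open>Suc t\<close>, then \<open>A - C\<close> is split at \<open>B\<close> and concavity bounds
  the part \<open>B - C\<close>.\<close>

lemma step_pointwise:
  assumes "C \<in> S" "A \<in> S" "B \<in> S"
  shows "real t * \<phi> C + \<phi> B + grad \<phi> C \<bullet> (A - B) - a * \<kappa> / real (Suc t)
    \<le> real (Suc t) * \<phi> ((real t / real (Suc t)) *\<^sub>R C + (1 / real (Suc t)) *\<^sub>R A)"
proof -
  define D where "D = (real t / real (Suc t)) *\<^sub>R C + (1 / real (Suc t)) *\<^sub>R A"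
  define s where "s = 1 / real (Suc t)"
  have s: "s > 0" "real (Suc t) * s = 1" "real t / real (Suc t) = 1 - s"
    by (auto simp: s_def field_simps)
  have DC: "D - C = s *\<^sub>R (A - C)"
    unfolding D_def s(3) s_def[symmetric] by (simp add: algebra_simps)
  have "D \<in> S"
    unfolding D_def using assms by (intro convexD[OF convex_S]) (auto simp: field_simps)
  have "real (Suc t) * (\<phi> C + s * (grad \<phi> C \<bullet> (A - C)) - \<kappa> / 2 * (s\<^sup>2 * (norm (A - C))\<^sup>2))
      \<le> real (Suc t) * \<phi> D"
    using tangent_lower[OF assms(1) \<open>D \<in> S\<close>] s(1) unfolding DC
    by (intro mult_left_mono) (simp_all add: power_mult_distrib)
  also have "real (Suc t) * (\<phi> C + s * (grad \<phi> C \<bullet> (A - C)) - \<kappa> / 2 * (s\<^sup>2 * (norm (A - C))\<^sup>2))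
      = real (Suc t) * \<phi> C + (real (Suc t) * s) * (grad \<phi> C \<bullet> (A - C))
        - (real (Suc t) * s) * (\<kappa> / 2 * s * (norm (A - C))\<^sup>2)"
    by (simp add: right_diff_distrib distrib_left power2_eq_square mult_ac del: of_nat_Suc)
  finally have "real (Suc t) * \<phi> C + grad \<phi> C \<bullet> (A - C) - \<kappa> / 2 * s * (norm (A - C))\<^sup>2
      \<le> real (Suc t) * \<phi> D"
    unfolding s(2) by simp
  moreover have "\<kappa> / 2 * s * (norm (A - C))\<^sup>2 \<le> \<kappa> / 2 * s * (2 * a)"
    using norm_diff_S[OF assms(2,1)] s(1) kappa_nonneg by (intro mult_left_mono) auto
  moreover have "\<kappa> / 2 * s * (2 * a) = a * \<kappa> / real (Suc t)" by (simp add: s_def del: of_nat_Suc)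
  moreover have "grad \<phi> C \<bullet> (A - C) = grad \<phi> C \<bullet> (A - B) + grad \<phi> C \<bullet> (B - C)"
    by (simp add: inner_diff_right)
  moreover have "real (Suc t) * \<phi> C = real t * \<phi> C + \<phi> C" by (simp add: algebra_simps)
  ultimately show ?thesis
    using tangent_upper[OF assms(1,3)] unfolding D_def[symmetric] by linarith
qed

lemma integrable_value: "t \<le> n \<Longrightarrow> integrable (iid P {1..n}) (\<lambda>\<omega>. \<phi> (Cm \<omega> t))"
  by (intro Pn.simple_function_integrable simple_function_compose1[of _ _ \<phi>] simple_Cm)

lemma step:
  assumes t: "Suc t \<le> n"
  shows "real t * value_at t + \<phi> (comparator h)
      - 2 * b * L * (\<integral>\<omega>. err (Suc t) \<omega> \<partial>iid P {1..n}) - a * \<kappa> / real (Suc t)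
    \<le> real (Suc t) * value_at (Suc t)"
proof -
  let ?gain = "\<lambda>\<omega>. grad \<phi> (Cm \<omega> t) \<bullet> (conf_at (Suc t) \<omega> - comparator h)"
  have tn: "Suc t \<in> {1..n}" using t by simp
  note int = integrable_value[OF Suc_leD[OF t]] integrable_value[OF t] integrable_gain[OF t] integrable_err[OF tn]
  have "(\<integral>\<omega>. real t * \<phi> (Cm \<omega> t) + \<phi> (comparator h) + ?gain \<omega> - a * \<kappa> / real (Suc t) \<partial>iid P {1..n})
      \<le> (\<integral>\<omega>. real (Suc t) * \<phi> (Cm \<omega> (Suc t)) \<partial>iid P {1..n})"
  proof (rule integral_mono)
    fix \<omega> assume w: "\<omega> \<in> space (iid P {1..n})"
    have "Cm \<omega> t \<in> S" using t by (intro Cm_in_S[OF _ _ w]) auto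
    moreover have "conf_at (Suc t) \<omega> \<in> S"
      using at_trial_in[OF yh tn _ w] tn by (intro conf_in_S label_in[OF tn w]) auto
    ultimately show "real t * \<phi> (Cm \<omega> t) + \<phi> (comparator h) + ?gain \<omega> - a * \<kappa> / real (Suc t)
        \<le> real (Suc t) * \<phi> (Cm \<omega> (Suc t))"
      unfolding omma_confusion.simps by (rule step_pointwise[OF _ _ comparator_in_S[OF h]])
  qed (use int t in auto)
  moreover have "0 \<le> integral\<^sup>L (iid P {1..n}) ?gain + 2 * b * L * (\<integral>\<omega>. err (Suc t) \<omega> \<partial>iid P {1..n})"
    using expected_gain[OF t] int by simp
  moreover have "(\<integral>\<omega>. real t * \<phi> (Cm \<omega> t) + \<phi> (comparator h) + ?gain \<omega> - a * \<kappa> / real (Suc t) \<partial>iid P {1..n})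
      = real t * value_at t + \<phi> (comparator h) + integral\<^sup>L (iid P {1..n}) ?gain - a * \<kappa> / real (Suc t)"
    using int t Pn.prob_space by simp
  moreover have "(\<integral>\<omega>. real (Suc t) * \<phi> (Cm \<omega> (Suc t)) \<partial>iid P {1..n}) = real (Suc t) * value_at (Suc t)"
    by simp
  ultimately show ?thesis by linarith
qed

text \<open>The weight \<open>real t\<close> makes both sides vanish at 0, so no term in
  \<open>\<phi> C0\<close> survives.\<close>

lemma telescoped:
  "t \<le> n \<Longrightarrow> real t * \<phi> (comparator h) - 2 * b * L * (\<Sum>s=1..t. \<integral>\<omega>. err s \<omega> \<partial>iid P {1..n})
      - a * \<kappa> * (\<Sum>s=1..t. 1 / real s) \<le> real t * value_at t"
proof (induction t)
  case (Suc t)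
  have "real (Suc t) * \<phi> (comparator h) = real t * \<phi> (comparator h) + \<phi> (comparator h)"
    by (simp add: algebra_simps)
  moreover have "2 * b * L * (\<Sum>s=1..Suc t. \<integral>\<omega>. err s \<omega> \<partial>iid P {1..n})
      = 2 * b * L * (\<Sum>s=1..t. \<integral>\<omega>. err s \<omega> \<partial>iid P {1..n})
        + 2 * b * L * (\<integral>\<omega>. err (Suc t) \<omega> \<partial>iid P {1..n})"
    by (simp add: distrib_left)
  moreover have "a * \<kappa> * (\<Sum>s=1..Suc t. 1 / real s) = a * \<kappa> * (\<Sum>s=1..t. 1 / real s) + a * \<kappa> / real (Suc t)"
    by (simp add: distrib_left)
  ultimately show ?case
    using step[OF Suc.prems] Suc.IH Suc.prems by linarith
qed simp

section \<open>The classifier's utility and the regret bound\<close>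

lemma mean_in_S:
  assumes "n \<ge> 1" "\<And>t. t \<in> {1..n} \<Longrightarrow> ys t \<in> Y" "\<And>t. t \<in> {1..n} \<Longrightarrow> vs t \<in> Yhat"
  shows "mean_confusion conf n ys vs \<in> S"
  unfolding mean_confusion_def scaleR_sum_right
  using assms by (intro convex_sum convex_S conf_in_S) auto

lemma simple_conf_coordinate:
  "t \<in> {1..n} \<Longrightarrow> simple_function (iid P {1..n}) (\<lambda>\<omega>. conf (snd (\<omega> t)) (h (fst (\<omega> t))))"
  by (rule simple_function_measurable_compose[OF simple_conf[OF h] coordinate])

lemma simple_mean_classifier:
  "simple_function (iid P {1..n}) (\<lambda>\<omega>. mean_confusion conf n (\<lambda>t. snd (\<omega> t)) (\<lambda>t. h (fst (\<omega> t))))"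
  unfolding mean_confusion_def
  by (rule simple_function_compose1[of _ "\<lambda>\<omega>. \<Sum>t=1..n. conf (snd (\<omega> t)) (h (fst (\<omega> t)))"
        "\<lambda>x. (1 / real n) *\<^sub>R x"])
    (intro simple_function_sum simple_conf_coordinate)

text \<open>Jensen through the tangent at the deterministic point \<open>comparator h\<close>: every
  coordinate has law \<open>P\<close>, so the linear term has mean zero.\<close>

lemma classifier_bound:
  assumes n: "n \<ge> 1"
  shows "classifier_utility conf P n \<phi> h \<le> \<phi> (comparator h)"
proof -
  let ?c = "\<lambda>t \<omega>. conf (snd (\<omega> t)) (h (fst (\<omega> t)))"
  let ?m = "\<lambda>\<omega>. mean_confusion conf n (\<lambda>t. snd (\<omega> t)) (\<lambda>t. h (fst (\<omega> t)))"
  let ?g = "grad \<phi> (comparator h)"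
  have Ec: "(\<integral>\<omega>. ?c t \<omega> \<partial>iid P {1..n}) = comparator h" if t: "t \<in> {1..n}" for t
  proof -
    have "comparator h = (\<integral>z. conf (snd z) (h (fst z)) \<partial>distr (iid P {1..n}) P (\<lambda>\<omega>. \<omega> t))"
      unfolding comparator_def distr_PiM_component[OF prob_space_P t] ..
    also have "\<dots> = (\<integral>\<omega>. ?c t \<omega> \<partial>iid P {1..n})"
      by (intro integral_distr coordinate t
          borel_measurable_simple_function simple_conf h)
    finally show ?thesis ..
  qed
  have m: "integrable (iid P {1..n}) ?m"
    by (rule Pn.simple_function_integrable[OF simple_mean_classifier])
  have Em: "(\<integral>\<omega>. ?m \<omega> \<partial>iid P {1..n}) = comparator h"
    unfolding mean_confusion_def using n Pn.simple_function_integrable[OF simple_conf_coordinate] Ec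
    by (simp add: sum_constant_scaleR)
  have "classifier_utility conf P n \<phi> h
      \<le> (\<integral>\<omega>. \<phi> (comparator h) + ?g \<bullet> (?m \<omega> - comparator h) \<partial>iid P {1..n})"
    unfolding classifier_utility_def
  proof (rule integral_mono)
    show "integrable (iid P {1..n}) (\<lambda>\<omega>. \<phi> (?m \<omega>))"
      by (intro Pn.simple_function_integrable simple_function_compose1[of _ _ \<phi>] simple_mean_classifier)
    show "integrable (iid P {1..n}) (\<lambda>\<omega>. \<phi> (comparator h) + ?g \<bullet> (?m \<omega> - comparator h))"
      using m by simp
    fix \<omega> assume w: "\<omega> \<in> space (iid P {1..n})"
    then have "?m \<omega> \<in> S"
      using measurable_space[OF h instance_in[OF _ w]] by (intro mean_in_S n label_in[OF _ w]) auto
    then show "\<phi> (?m \<omega>) \<le> \<phi> (comparator h) + ?g \<bullet> (?m \<omega> - comparator h)"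
      by (rule tangent_upper[OF comparator_in_S[OF h]])
  qed
  also have "\<dots> = \<phi> (comparator h)"
    using m Em Pn.prob_space by simp
  finally show ?thesis .
qed

text \<open>The one-sided errors are separate: \<open>c\<close> is paid when the classifier passes
  from \<psi> to \<phi>, \<open>d\<close> when the online value passes back. A smoothing from below
  has \<open>d = 0\<close>, the Moreau envelope \<open>c = 0\<close>.\<close>

theorem regret_bound:
  assumes n: "n \<ge> 1"
    and le: "\<And>C. C \<in> S \<Longrightarrow> \<psi> C \<le> \<phi> C + c"
    and ge: "\<And>C. C \<in> S \<Longrightarrow> \<phi> C \<le> \<psi> C + d"
  shows "regret conf P n \<psi> h yh \<le> c + d + a * \<kappa> * (1 + ln (real n)) / real n
    + 2 * b * L / real n * total_estimation_error P n \<eta> \<eta>h"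
proof -
  let ?m = "\<lambda>\<omega>. mean_confusion conf n (\<lambda>t. snd (\<omega> t)) (\<lambda>t. h (fst (\<omega> t)))"
  have int_m: "integrable (iid P {1..n}) (\<lambda>\<omega>. f (?m \<omega>))" for f :: "'c \<Rightarrow> real"
    by (intro Pn.simple_function_integrable simple_function_compose1[of _ _ f] simple_mean_classifier)
  have int_C: "integrable (iid P {1..n}) (\<lambda>\<omega>. f (Cm \<omega> n))" for f :: "'c \<Rightarrow> real"
    by (intro Pn.simple_function_integrable simple_function_compose1[of _ _ f] simple_Cm) simp
  have "classifier_utility conf P n \<psi> h \<le> (\<integral>\<omega>. \<phi> (?m \<omega>) + c \<partial>iid P {1..n})"
    unfolding classifier_utility_def
  proof (rule integral_mono)
    fix \<omega> assume w: "\<omega> \<in> space (iid P {1..n})"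
    then have "?m \<omega> \<in> S"
      using measurable_space[OF h instance_in[OF _ w]] by (intro mean_in_S n label_in[OF _ w]) auto
    then show "\<psi> (?m \<omega>) \<le> \<phi> (?m \<omega>) + c" by (rule le)
  qed (use int_m in auto)
  also have "\<dots> = classifier_utility conf P n \<phi> h + c"
    unfolding classifier_utility_def using int_m Pn.prob_space by simp
  also have "\<dots> \<le> \<phi> (comparator h) + c"
    using classifier_bound[OF n] by simp
  finally have 1: "classifier_utility conf P n \<psi> h \<le> \<phi> (comparator h) + c" .
  have "value_at n \<le> (\<integral>\<omega>. \<psi> (Cm \<omega> n) + d \<partial>iid P {1..n})"
    by (intro integral_mono ge Cm_in_S) (use int_C in auto)
  also have "\<dots> = online_utility conf P n \<psi> yh + d"
    unfolding online_utility_def omma_confusion_eq_mean[OF n, symmetric, where ?C0.0 = C0]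
    using int_C[of \<psi>] Pn.prob_space by simp
  finally have 2: "value_at n \<le> online_utility conf P n \<psi> yh + d" .
  have "a * \<kappa> * (\<Sum>s=1..n. 1 / real s) \<le> a * \<kappa> * (1 + ln (real n))"
    using sum_inverse_le_ln[OF n] a_nonneg kappa_nonneg by (intro mult_left_mono) auto
  with telescoped[of n]
  have "real n * \<phi> (comparator h) - real n * value_at n
      \<le> a * \<kappa> * (1 + ln (real n)) + 2 * b * L * total_estimation_error P n \<eta> \<eta>h"
    unfolding total_estimation_error_def by simp
  then have "\<phi> (comparator h) - value_at n
      \<le> (a * \<kappa> * (1 + ln (real n)) + 2 * b * L * total_estimation_error P n \<eta> \<eta>h) / real n"
    using n by (simp add: pos_le_divide_eq right_diff_distrib mult.commute[of _ "real n"])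
  also have "\<dots> = a * \<kappa> * (1 + ln (real n)) / real n + 2 * b * L / real n * total_estimation_error P n \<eta> \<eta>h"
    by (simp add: add_divide_distrib)
  finally show ?thesis using 1 2 unfolding regret_def by linarith
qed

end

subsection \<open>Tuning and instantiation\<close>

text \<open>This \<gamma> makes the approximation term and the smoothness term equal, each being the
  square root on the right.\<close>

lemma smoothing_parameter_tuning:
  fixes a \<alpha> \<beta> K N \<gamma> :: real
  assumes pos: "a > 0" "\<alpha> > 0" "\<beta> > 0" "K > 0" "N > 0"
    and \<gamma>: "\<gamma> = sqrt (a * \<beta> * K / (\<alpha> * N))"
  shows "\<gamma> > 0" "\<alpha> * \<gamma> + a * (\<beta> / \<gamma>) * K / N = 2 * sqrt (a * \<alpha> * \<beta> * K / N)"
proof -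
  let ?R = "sqrt (a * \<alpha> * \<beta> * K / N)"
  show g: "\<gamma> > 0" using pos by (simp add: \<gamma>)
  have "\<alpha> * \<gamma> = sqrt (\<alpha>\<^sup>2 * (a * \<beta> * K / (\<alpha> * N)))"
    unfolding \<gamma> using pos by (subst real_sqrt_mult) simp
  also have "\<alpha>\<^sup>2 * (a * \<beta> * K / (\<alpha> * N)) = a * \<alpha> * \<beta> * K / N"
    using pos by (simp add: power2_eq_square)
  finally have 1: "\<alpha> * \<gamma> = ?R" .
  have "a * \<beta> * K / N = \<alpha> * \<gamma>\<^sup>2" using pos by (simp add: \<gamma>)
  moreover have "a * (\<beta> / \<gamma>) * K / N = (a * \<beta> * K / N) / \<gamma>" by simp
  ultimately have "a * (\<beta> / \<gamma>) * K / N = \<alpha> * \<gamma>"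
    using g by (simp add: power2_eq_square)
  then show "\<alpha> * \<gamma> + a * (\<beta> / \<gamma>) * K / N = 2 * ?R"
    using 1 by simp
qed

context omma_setting
begin

lemma regret_smoothing:
  assumes n: "n \<ge> 1" and h: "h \<in> X \<rightarrow>\<^sub>M count_space Yhat" and pos: "\<alpha> > 0" "\<beta> > 0"
    and smoothing: "smoothing S \<psi> \<Psi> \<alpha> \<beta>"
    and \<gamma>: "\<gamma> = sqrt (a * \<beta> * (1 + ln (real n)) / (\<alpha> * real n))"
    and lip: "L-lipschitz_on S (\<Psi> \<gamma>)"
    and omma: "omma conf Y Yhat X P n (\<Psi> \<gamma>) C0 \<eta>h yh"
  shows "regret conf P n \<psi> h yh \<le> 2 * sqrt (a * \<alpha> * \<beta> * (1 + ln (real n)) / real n)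
    + 2 * b * L / real n * total_estimation_error P n \<eta> \<eta>h"
proof -
  have "1 + ln (real n) > 0" "real n > 0" using n by (auto intro: add_pos_nonneg)
  note tuning = smoothing_parameter_tuning[OF a_pos pos this \<gamma>]
  interpret omma_run conf Y Yhat off lin a b X P \<eta> n Q \<eta>h "\<Psi> \<gamma>" C0 yh h "\<beta> / \<gamma>" L
    using omma smoothing_smooth_concave_on[OF smoothing tuning(1) lip] h pos tuning(1)
      lipschitz_on_nonneg[OF lip] by unfold_locales auto
  have "regret conf P n \<psi> h yh \<le> \<alpha> * \<gamma> + 0 + a * (\<beta> / \<gamma>) * (1 + ln (real n)) / real n
      + 2 * b * L / real n * total_estimation_error P n \<eta> \<eta>h"
    using smoothing tuning(1) unfolding smoothing_def
    by (intro regret_bound[OF n]) (auto simp: diff_le_eq add.commute)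
  then show ?thesis using tuning(2) by simp
qed

lemma regret_moreau:
  assumes n: "n \<ge> 1" and h: "h \<in> X \<rightarrow>\<^sub>M count_space Yhat" and pos: "L > 0"
    and concave: "concave_on S \<psi>" and lip: "L-lipschitz_on S \<psi>"
    and \<gamma>: "\<gamma> = sqrt (2 * a * (1 + ln (real n)) / (L\<^sup>2 * real n))"
    and omma: "omma conf Y Yhat X P n (moreau_smoothing S \<psi> \<gamma>) C0 \<eta>h yh"
  shows "regret conf P n \<psi> h yh \<le> L * sqrt (2 * a * (1 + ln (real n)) / real n)
    + 2 * b * L / real n * total_estimation_error P n \<eta> \<eta>h"
proof -
  let ?K = "1 + ln (real n)"
  have K: "?K > 0" "real n > 0" using n by (auto intro: add_pos_nonneg)
  \<comment> \<open>The Moreau case is the same tuning with \<alpha> = \<open>L\<^sup>2 / 2\<close>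
    and \<beta> = 1.\<close>
  have "\<gamma> = sqrt (a * 1 * ?K / (L\<^sup>2 / 2 * real n))" using \<gamma> by simp
  note tuning = smoothing_parameter_tuning[OF a_pos _ zero_less_one K this]
  have g: "\<gamma> > 0" using tuning(1) pos by simp
  have "S \<noteq> {}" using omma by (auto simp: omma_def)
  then interpret M: moreau S \<psi> \<gamma> L
    using compact_S concave lip g by unfold_locales
  interpret omma_run conf Y Yhat off lin a b X P \<eta> n Q \<eta>h "moreau_smoothing S \<psi> \<gamma>" C0 yh h "1 / \<gamma>" L
    using omma M.moreau_smooth_concave_on h pos g by unfold_locales auto
  have "regret conf P n \<psi> h yh \<le> 0 + L\<^sup>2 * \<gamma> / 2 + a * (1 / \<gamma>) * ?K / real n
      + 2 * b * L / real n * total_estimation_error P n \<eta> \<eta>h"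
    using M.moreau_ge M.moreau_le by (intro regret_bound[OF n]) auto
  moreover have "L\<^sup>2 / 2 * \<gamma> + a * (1 / \<gamma>) * ?K / real n = 2 * sqrt (a * (L\<^sup>2 / 2) * 1 * ?K / real n)"
    using tuning(2) pos by simp
  moreover have "2 * sqrt (a * (L\<^sup>2 / 2) * 1 * ?K / real n) = L * sqrt (2 * a * ?K / real n)"
  proof -
    have "2 * sqrt (a * (L\<^sup>2 / 2) * 1 * ?K / real n) = sqrt (2\<^sup>2 * (a * (L\<^sup>2 / 2) * 1 * ?K / real n))"
      by (simp only: real_sqrt_mult real_sqrt_abs abs_numeral)
    also have "2\<^sup>2 * (a * (L\<^sup>2 / 2) * 1 * ?K / real n) = L\<^sup>2 * (2 * a * ?K / real n)"
      by simp
    also have "sqrt \<dots> = L * sqrt (2 * a * ?K / real n)"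
      using pos by (simp only: real_sqrt_mult real_sqrt_abs abs_of_pos)
    finally show ?thesis .
  qed
  ultimately show ?thesis by simp
qed

end

section \<open>Multi-class confusion matrices\<close>

lemma inner_mc_confusion: "mc_confusion q v \<bullet> mc_confusion q' v' = (q \<bullet> q') * (v \<bullet> v')"
  unfolding mc_confusion_def inner_vec_def by (simp add: sum_product mult_ac)

lemma norm_mc_confusion: "norm (mc_confusion q v) = norm q * norm v"
  unfolding norm_eq_sqrt_inner inner_mc_confusion by (rule real_sqrt_mult)

text \<open>Origin of the factor 2 a: expanding the square gives 2 a minus twice the inner product,
  which is nonnegative for matrices with nonnegative entries.\<close>

lemma norm_diff_sq_le_of_acute:
  fixes A B :: "'c::real_inner"
  assumes "A \<bullet> A = a" "B \<bullet> B = a" "A \<bullet> B \<ge> 0"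
  shows "(norm (A - B))\<^sup>2 \<le> 2 * a"
  using assms unfolding power2_norm_eq_inner by (simp add: inner_diff inner_commute)

lemma one_hot_inner: "y \<in> one_hot \<Longrightarrow> y' \<in> one_hot \<Longrightarrow> 0 \<le> y \<bullet> y'"
  and one_hot_inner_self: "y \<in> one_hot \<Longrightarrow> y \<bullet> y = 1"
  by (auto simp: one_hot_def inner_axis_axis)

lemma one_hot_sum: "y \<in> one_hot \<Longrightarrow> (\<Sum>j\<in>UNIV. y $ j) = 1"
  by (auto simp: one_hot_def axis_def)

text \<open>Outer products are bilinear, so there is no offset, and norms multiply; one-hot vectors
  have norm 1, whence both constants are 1.\<close>

lemma affine_confusion_mc:
  "affine_confusion mc_confusion one_hot (one_hot :: (real^'m) set)
    (\<lambda>_. 0) (\<lambda>v q. mc_confusion q v) 1 1"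
proof (rule affine_confusion.intro)
  show "finite (one_hot :: (real^'m) set)" by (simp add: one_hot_def)
  then show "finite (one_hot :: (real^'m) set)" .
  fix y v y' v' q :: "real^'m"
  show "linear (\<lambda>q. mc_confusion q v)"
    by (rule linearI) (simp_all add: mc_confusion_def vec_eq_iff algebra_simps)
  assume v: "v \<in> one_hot"
  then show "norm (mc_confusion q v) \<le> 1 * norm q"
    using norm_eq_1[THEN iffD2, OF one_hot_inner_self[OF v]] by (simp add: norm_mc_confusion)
  assume "y \<in> one_hot" "y' \<in> one_hot" "v' \<in> one_hot"
  then show "(norm (mc_confusion y v - mc_confusion y' v'))\<^sup>2 \<le> 2 * 1"
    using v by (intro norm_diff_sq_le_of_acute)
      (simp_all add: inner_mc_confusion one_hot_inner one_hot_inner_self)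
qed auto

lemma probability_vectors_subset_hull: "probability_vectors \<subseteq> convex hull one_hot"
proof
  fix q :: "real^'m" assume q: "q \<in> probability_vectors"
  have "(\<Sum>j\<in>UNIV. q $ j *\<^sub>R axis j 1) \<in> convex hull one_hot"
    using q by (intro convex_sum convex_convex_hull hull_inc)
      (auto simp: probability_vectors_def one_hot_def)
  moreover have "(\<Sum>j\<in>UNIV. q $ j *\<^sub>R axis j 1) = q"
    using basis_expansion[of q] by (simp add: scalar_mult_eq_scaleR)
  ultimately show "q \<in> convex hull one_hot" by simp
qed

section \<open>Multi-label confusion matrices\<close>

lemma finite_binary_vectors: "finite (binary_vectors :: (real^'m) set)"
proof (rule finite_subset)
  show "binary_vectors \<subseteq> (\<lambda>J. \<chi> j. of_bool (j \<in> J)) ` (UNIV :: 'm set set)"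
  proof
    fix y :: "real^'m" assume "y \<in> binary_vectors"
    then have "y = (\<chi> j. of_bool (j \<in> {j. y $ j = 1}))"
      by (auto simp: binary_vectors_def vec_eq_iff)
    then show "y \<in> range (\<lambda>J. \<chi> j. of_bool (j \<in> J))" by (rule range_eqI)
  qed
qed simp

lemma unit_box_subset_hull: "(unit_box :: (real^'m) set) \<subseteq> convex hull binary_vectors"
proof -
  have "unit_box = cbox (0 :: real^'m) 1"
    by (auto simp: unit_box_def mem_box_cart)
  also have "\<dots> = convex hull binary_vectors"
    unfolding Cart_1 unit_interval_convex_hull
    by (simp add: binary_vectors_def Basis_vec_def inner_axis)
  finally show ?thesis by simp
qed

text \<open>For binary \<open>y\<close> the indicator of \<open>y = u\<close> is \<open>y\<close>
  when \<open>u\<close> holds and \<open>1 - y\<close> otherwise. This is the constant part;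
  \<open>ml_linear\<close> carries the signed part.\<close>

definition ml_offset :: "real^'m \<Rightarrow> real^bool^bool^'m" where
  "ml_offset v = (\<chi> j u w. of_bool (\<not> u) * of_bool (v $ j = of_bool w))"

definition ml_linear :: "real^'m \<Rightarrow> real^'m \<Rightarrow> real^bool^bool^'m" where
  "ml_linear v q = (\<chi> j u w. (if u then 1 else -1) * q $ j * of_bool (v $ j = of_bool w))"

text \<open>Each label contributes exactly one entry 1, so the squared norm is the number of labels.
  A mean label enters the rows of both values of \<open>u\<close>, with opposite signs, which
  doubles the squared norm and gives \<open>sqrt 2\<close>.\<close>

lemma affine_confusion_ml:
  fixes Yhat :: "(real^'m) set"
  assumes Yhat: "Yhat \<subseteq> binary_vectors"
  shows "affine_confusion ml_confusion binary_vectors Yhat ml_offset ml_linear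
    (real CARD('m)) (sqrt 2)"
proof (rule affine_confusion.intro)
  show "finite (binary_vectors :: (real^'m) set)" by (rule finite_binary_vectors)
  then show "finite Yhat" using Yhat by (rule rev_finite_subset)
  fix y v y' v' q :: "real^'m"
  show "linear (ml_linear v)"
    by (rule linearI) (simp_all add: ml_linear_def vec_eq_iff algebra_simps)
  have bin: "z $ j = 0 \<or> z $ j = 1" if "z \<in> binary_vectors" for z :: "real^'m" and j
    using that by (auto simp: binary_vectors_def)
  assume "v \<in> Yhat"
  then have v: "v \<in> binary_vectors" using Yhat by blast
  have one: "of_bool (v $ j = 1) + of_bool (v $ j = 0) = (1::real)" for j
    using bin[OF v, of j] by auto
  have "ml_linear v q \<bullet> ml_linear v q = (\<Sum>j\<in>UNIV. 2 * (q $ j)\<^sup>2)"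
    unfolding ml_linear_def inner_vec_def
  proof (simp add: UNIV_bool power2_eq_square, rule sum.cong[OF refl])
  qed (use bin[OF v] in auto)
  also have "\<dots> = 2 * (q \<bullet> q)"
    by (simp add: inner_vec_def sum_distrib_left power2_eq_square)
  finally have "norm (ml_linear v q) = sqrt 2 * norm q"
    by (simp add: norm_eq_sqrt_inner real_sqrt_mult)
  then show "norm (ml_linear v q) \<le> sqrt 2 * norm q" by simp
  assume y: "y \<in> binary_vectors"
  show "ml_confusion y v = ml_offset v + ml_linear v y"
    using bin[OF y] by (auto simp: ml_confusion_def ml_offset_def ml_linear_def vec_eq_iff)
  have self: "ml_confusion z w \<bullet> ml_confusion z w = real CARD('m)"
    if "z \<in> binary_vectors" "w \<in> binary_vectors" for z w :: "real^'m"
  proof -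
    have "ml_confusion z w \<bullet> ml_confusion z w = (\<Sum>j\<in>(UNIV :: 'm set). 1)"
      unfolding ml_confusion_def inner_vec_def
      using bin[OF that(1)] bin[OF that(2)] by (intro sum.cong refl) (auto simp: UNIV_bool)
    then show ?thesis by simp
  qed
  assume "y' \<in> binary_vectors" "v' \<in> Yhat"
  then show "(norm (ml_confusion y v - ml_confusion y' v'))\<^sup>2 \<le> 2 * real CARD('m)"
    using y v Yhat
    by (intro norm_diff_sq_le_of_acute self)
      (auto simp: ml_confusion_def inner_vec_def intro!: sum_nonneg)
qed auto

section \<open>The two settings as instances\<close>

lemma omma_setting_mc:
  assumes data: "data_model X one_hot P \<eta>" and est: "estimates X P n probability_vectors \<eta>h"
  shows "omma_setting mc_confusion one_hot one_hot (\<lambda>_. 0) (\<lambda>v q. mc_confusion q v) 1 1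
    X P \<eta> n probability_vectors \<eta>h"
proof -
  interpret affine_confusion mc_confusion one_hot one_hot "\<lambda>_. 0" "\<lambda>v q. mc_confusion q v" 1 1
    by (rule affine_confusion_mc)
  interpret label_model X one_hot P \<eta>
    using data finite_Y by unfold_locales
  have "AE z in P. (\<Sum>j\<in>UNIV. \<eta> (fst z) $ j) = 1"
    by (rule AE_eta_sum) (rule one_hot_sum)
  then have "AE z in P. \<eta> (fst z) \<in> convex hull one_hot"
    using AE_space
  proof eventually_elim
    case (elim z)
    then have "\<eta> (fst z) \<in> unit_box" by (intro eta_box) (auto simp: space_P)
    then have "\<eta> (fst z) \<in> probability_vectors"
      using elim(1) by (auto simp: unit_box_def probability_vectors_def one_hot_def axis_def)
    then show ?case using probability_vectors_subset_hull by blast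
  qed
  then show ?thesis
    using est probability_vectors_subset_hull by unfold_locales
qed

lemma omma_setting_ml:
  fixes Yhat :: "(real^'m) set"
  assumes Yhat: "Yhat \<subseteq> binary_vectors"
    and data: "data_model X binary_vectors P \<eta>" and est: "estimates X P n unit_box \<eta>h"
  shows "omma_setting ml_confusion binary_vectors Yhat ml_offset ml_linear (real CARD('m)) (sqrt 2)
    X P \<eta> n unit_box \<eta>h"
proof -
  interpret affine_confusion ml_confusion binary_vectors Yhat ml_offset ml_linear
      "real CARD('m)" "sqrt 2"
    by (rule affine_confusion_ml) fact
  interpret label_model X binary_vectors P \<eta>
    using data finite_binary_vectors by unfold_locales
  have "AE z in P. \<eta> (fst z) \<in> convex hull binary_vectors"
    using AE_space
  proof eventually_elim
    case (elim z)
    then have "\<eta> (fst z) \<in> unit_box" by (intro eta_box) (auto simp: space_P)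
    then show ?case using unit_box_subset_hull by blast
  qed
  then show ?thesis
    using est unit_box_subset_hull by unfold_locales
qed

lemma optimal_classifier_measurable:
  "optimal_classifier conf Yhat X P n \<psi> h \<Longrightarrow> h \<in> X \<rightarrow>\<^sub>M count_space Yhat"
  by (simp add: optimal_classifier_def is_arg_max_def)

theorem mainTheorem2:
  fixes X :: "'x measure" and n :: nat
  assumes "n \<ge> 1"
  shows "(\<forall>(P :: ('x \<times> (real^'m)) measure) \<eta> \<eta>h (\<psi> :: real^'m^'m \<Rightarrow> real) hstar.
       let a = 1 :: real; b = 1 :: real; S = confusion_hull mc_confusion one_hot one_hot in
       data_model X one_hot P \<eta> \<longrightarrow>
       estimates X P n probability_vectors \<eta>h \<longrightarrow>
       closed_concave_on S \<psi> \<longrightarrow>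
       optimal_classifier mc_confusion one_hot X P n \<psi> hstar \<longrightarrow>
       (\<forall>\<Psi> \<alpha> \<beta> L\<gamma> \<gamma> C0 yh.
          \<alpha> > 0 \<longrightarrow> \<beta> > 0 \<longrightarrow> smoothing S \<psi> \<Psi> \<alpha> \<beta> \<longrightarrow>
          \<gamma> = sqrt (a * \<beta> * (1 + ln (real n)) / (\<alpha> * real n)) \<longrightarrow>
          L\<gamma>-lipschitz_on S (\<Psi> \<gamma>) \<longrightarrow>
          omma mc_confusion one_hot one_hot X P n (\<Psi> \<gamma>) C0 \<eta>h yh \<longrightarrow>
          regret mc_confusion P n \<psi> hstar yh
            \<le> 2 * sqrt (a * \<alpha> * \<beta> * (1 + ln (real n)) / real n)
              + 2 * b * L\<gamma> / real n * total_estimation_error P n \<eta> \<eta>h) \<and>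
       (\<forall>L \<gamma> C0 yh.
          L > 0 \<longrightarrow> L-lipschitz_on S \<psi> \<longrightarrow>
          \<gamma> = sqrt (2 * a * (1 + ln (real n)) / (L\<^sup>2 * real n)) \<longrightarrow>
          omma mc_confusion one_hot one_hot X P n (moreau_smoothing S \<psi> \<gamma>) C0 \<eta>h yh \<longrightarrow>
          regret mc_confusion P n \<psi> hstar yh
            \<le> L * sqrt (2 * a * (1 + ln (real n)) / real n)
              + 2 * b * L / real n * total_estimation_error P n \<eta> \<eta>h))
    \<and>
    (\<forall>(Yhat :: (real^'m) set) (P :: ('x \<times> (real^'m)) measure) \<eta> \<eta>h (\<psi> :: real^bool^bool^'m \<Rightarrow> real) hstar.
       Yhat \<noteq> {} \<longrightarrow> Yhat \<subseteq> binary_vectors \<longrightarrow> (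
       let a = real CARD('m); b = sqrt 2; S = confusion_hull ml_confusion binary_vectors Yhat in
       data_model X binary_vectors P \<eta> \<longrightarrow>
       estimates X P n unit_box \<eta>h \<longrightarrow>
       closed_concave_on S \<psi> \<longrightarrow>
       optimal_classifier ml_confusion Yhat X P n \<psi> hstar \<longrightarrow>
       (\<forall>\<Psi> \<alpha> \<beta> L\<gamma> \<gamma> C0 yh.
          \<alpha> > 0 \<longrightarrow> \<beta> > 0 \<longrightarrow> smoothing S \<psi> \<Psi> \<alpha> \<beta> \<longrightarrow>
          \<gamma> = sqrt (a * \<beta> * (1 + ln (real n)) / (\<alpha> * real n)) \<longrightarrow>
          L\<gamma>-lipschitz_on S (\<Psi> \<gamma>) \<longrightarrow>
          omma ml_confusion binary_vectors Yhat X P n (\<Psi> \<gamma>) C0 \<eta>h yh \<longrightarrow>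
          regret ml_confusion P n \<psi> hstar yh
            \<le> 2 * sqrt (a * \<alpha> * \<beta> * (1 + ln (real n)) / real n)
              + 2 * b * L\<gamma> / real n * total_estimation_error P n \<eta> \<eta>h) \<and>
       (\<forall>L \<gamma> C0 yh.
          L > 0 \<longrightarrow> L-lipschitz_on S \<psi> \<longrightarrow>
          \<gamma> = sqrt (2 * a * (1 + ln (real n)) / (L\<^sup>2 * real n)) \<longrightarrow>
          omma ml_confusion binary_vectors Yhat X P n (moreau_smoothing S \<psi> \<gamma>) C0 \<eta>h yh \<longrightarrow>
          regret ml_confusion P n \<psi> hstar yh
            \<le> L * sqrt (2 * a * (1 + ln (real n)) / real n)
              + 2 * b * L / real n * total_estimation_error P n \<eta> \<eta>h)))"
proof (rule conjI; intro allI impI; unfold Let_def; intro allI impI; rule conjI; intro allI impI)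
  fix P :: "('x \<times> (real^'m)) measure" and \<eta> \<eta>h and \<psi> :: "real^'m^'m \<Rightarrow> real" and h
  let ?S = "confusion_hull mc_confusion one_hot one_hot :: (real^'m^'m) set"
  assume data: "data_model X one_hot P \<eta>" "estimates X P n probability_vectors \<eta>h"
    and concave: "closed_concave_on ?S \<psi>"
    and h: "optimal_classifier mc_confusion one_hot X P n \<psi> h"
  note setting = omma_setting_mc[OF data] and h = optimal_classifier_measurable[OF h]
  show "regret mc_confusion P n \<psi> h yh \<le> 2 * sqrt (1 * \<alpha> * \<beta> * (1 + ln (real n)) / real n)
      + 2 * 1 * L / real n * total_estimation_error P n \<eta> \<eta>h"
    if "\<alpha> > 0" "\<beta> > 0" "smoothing ?S \<psi> \<Psi> \<alpha> \<beta>"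
      "\<gamma> = sqrt (1 * \<beta> * (1 + ln (real n)) / (\<alpha> * real n))" "L-lipschitz_on ?S (\<Psi> \<gamma>)"
      "omma mc_confusion one_hot one_hot X P n (\<Psi> \<gamma>) C0 \<eta>h yh" for \<Psi> \<alpha> \<beta> L \<gamma> C0 yh
    by (rule omma_setting.regret_smoothing[OF setting assms h that])
  show "regret mc_confusion P n \<psi> h yh \<le> L * sqrt (2 * 1 * (1 + ln (real n)) / real n)
      + 2 * 1 * L / real n * total_estimation_error P n \<eta> \<eta>h"
    if "L > 0" "L-lipschitz_on ?S \<psi>" "\<gamma> = sqrt (2 * 1 * (1 + ln (real n)) / (L\<^sup>2 * real n))"
      "omma mc_confusion one_hot one_hot X P n (moreau_smoothing ?S \<psi> \<gamma>) C0 \<eta>h yh" for L \<gamma> C0 yh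
    using concave unfolding closed_concave_on_def
    by (intro omma_setting.regret_moreau[OF setting assms h that(1) _ that(2-4)]) simp
next
  fix Yhat :: "(real^'m) set" and P :: "('x \<times> (real^'m)) measure" and \<eta> \<eta>h
    and \<psi> :: "real^bool^bool^'m \<Rightarrow> real" and h
  let ?S = "confusion_hull ml_confusion binary_vectors Yhat"
  assume Yhat: "Yhat \<subseteq> binary_vectors"
    and data: "data_model X binary_vectors P \<eta>" "estimates X P n unit_box \<eta>h"
    and concave: "closed_concave_on ?S \<psi>"
    and h: "optimal_classifier ml_confusion Yhat X P n \<psi> h"
  note setting = omma_setting_ml[OF Yhat data] and h = optimal_classifier_measurable[OF h]
  show "regret ml_confusion P n \<psi> h yh
      \<le> 2 * sqrt (real CARD('m) * \<alpha> * \<beta> * (1 + ln (real n)) / real n)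
        + 2 * sqrt 2 * L / real n * total_estimation_error P n \<eta> \<eta>h"
    if "\<alpha> > 0" "\<beta> > 0" "smoothing ?S \<psi> \<Psi> \<alpha> \<beta>"
      "\<gamma> = sqrt (real CARD('m) * \<beta> * (1 + ln (real n)) / (\<alpha> * real n))" "L-lipschitz_on ?S (\<Psi> \<gamma>)"
      "omma ml_confusion binary_vectors Yhat X P n (\<Psi> \<gamma>) C0 \<eta>h yh" for \<Psi> \<alpha> \<beta> L \<gamma> C0 yh
    by (rule omma_setting.regret_smoothing[OF setting assms h that])
  show "regret ml_confusion P n \<psi> h yh
      \<le> L * sqrt (2 * real CARD('m) * (1 + ln (real n)) / real n)
        + 2 * sqrt 2 * L / real n * total_estimation_error P n \<eta> \<eta>h"
    if "L > 0" "L-lipschitz_on ?S \<psi>"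
      "\<gamma> = sqrt (2 * real CARD('m) * (1 + ln (real n)) / (L\<^sup>2 * real n))"
      "omma ml_confusion binary_vectors Yhat X P n (moreau_smoothing ?S \<psi> \<gamma>) C0 \<eta>h yh" for L \<gamma> C0 yh
    using concave unfolding closed_concave_on_def
    by (intro omma_setting.regret_moreau[OF setting assms h that(1) _ that(2-4)]) simp
qed

end
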